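(* Let $X$ be a nonzero complex Banach space with open unit ball $\mathbb{B}$, and let $\beta\in\mathbb{R}$ with $|\beta|\le \pi/3$. Let $g:\mathbb{B}\to\mathbb{C}$ be holomorphic with $g(0)=1$, define $F(x)=g(x)x$ for $x\in\mathbb{B}$, and suppose that $F\in\widehat{\mathcal{S}}_{\beta}(\mathbb{B})$. Then, for every $x_0\in X$ with $\|x_0\|=1$ and every $T_{x_0}\in T(x_0)$, $$|H_{2,2}(F)|=|A_2A_4-A_3^2|\le \cos^2\beta .$$ Moreover, the estimate is sharp: there exist a holomorphic function $g:\mathbb{B}\to\mathbb{C}$ with $g(0)=1$ such that the mapping $F(x)=g(x)x$, $x\in\mathbb{B}$, belongs to $\widehat{\mathcal{S}}_{\beta}(\mathbb{B})$, a unit vector $x_0\in X$ and $T_{x_0}\in T(x_0)$ for which equality $|A_2A_4-A_3^2|=\cos^2\beta$ holds.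
   Context: $X$ is a complex Banach space with norm $\|\cdot\|$ and $\mathbb{B}=\{x\in X:\|x\|<1\}$. For $x\in X\setminus\{0\}$, $T(x)$ is the (nonempty) set of bounded linear functionals $T_x:X\to\mathbb{C}$ with $T_x(x)=\|x\|$ and $\|T_x\|=1$. For a holomorphic mapping $F$ on $\mathbb{B}$, $DF(x)$ is the Fréchet derivative at $x$ and $D^nF(0)$ is the $n$-th Fréchet derivative at $0$ (a bounded symmetric $n$-linear operator). A holomorphic $F:\mathbb{B}\to X$ is normalized if $F(0)=0$ and $DF(0)=I$ (the identity); it is locally biholomorphic if $DF(x)$ is invertible with bounded inverse for every $x\in\mathbb{B}$. For $|\beta|<\pi/2$, $\widehat{\mathcal{S}}_{\beta}(\mathbb{B})$ denotes the class of $\beta$-spirallike mappings: normalized locally biholomorphic mappings $F:\mathbb{B}\to X$ such that $$\operatorname{Re}\left(e^{-i\beta}\,T_x\bigl((DF(x))^{-1}F(x)\bigr)\right)>0\qquad\text{for all }x\in\mathbb{B}\setminus\{0\},\ T_x\in T(x).$$ Given a unit vector $x_0$ and $T_{x_0}\in T(x_0)$, for $n=2,3,4$ put $$A_n=\frac{1}{n!}\,T_{x_0}\bigl(D^nF(0)(x_0,\ldots,x_0)\bigr)\quad(x_0\text{ repeated }n\text{ times}),$$ and $H_{2,2}(F)=\begin{vmatrix}A_2&A_3\\ A_3&A_4\end{vmatrix}=A_2A_4-A_3^2$. *)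

theory Defs
  imports "HOL-Analysis.Analysis" "HOL-Complex_Analysis.Complex_Analysis"
begin

(* Complex Banach spaces: a complex scalar multiplication extending the real one, for which the
   given complete norm is absolutely homogeneous over the complex numbers. *)

class complex_banach = banach +
  fixes scaleC :: "complex \<Rightarrow> 'a \<Rightarrow> 'a"  (infixr "*\<^sub>C" 75)
  assumes scaleC_add_right: "a *\<^sub>C (x + y) = a *\<^sub>C x + a *\<^sub>C y"
    and scaleC_add_left: "(a + b) *\<^sub>C x = a *\<^sub>C x + b *\<^sub>C x"
    and scaleC_scaleC: "a *\<^sub>C b *\<^sub>C x = (a * b) *\<^sub>C x"
    and scaleC_of_real: "complex_of_real r *\<^sub>C x = r *\<^sub>R x"
    and norm_scaleC: "norm (a *\<^sub>C x) = cmod a * norm x"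

instantiation complex :: complex_banach
begin

definition scaleC_complex :: "complex \<Rightarrow> complex \<Rightarrow> complex" where
  "scaleC_complex a x = a * x"

instance
  by standard (simp_all add: scaleC_complex_def algebra_simps norm_mult scaleR_conv_of_real)

end

definition bounded_clinear :: "('a::complex_banach \<Rightarrow> 'b::complex_banach) \<Rightarrow> bool" where
  "bounded_clinear L \<longleftrightarrow> bounded_linear L \<and> (\<forall>c x. L (c *\<^sub>C x) = c *\<^sub>C L x)"

(* Complex Frechet differentiability at every point; meant for open S. *)

definition holomorphic_map_on ::
    "('a::complex_banach \<Rightarrow> 'b::complex_banach) \<Rightarrow> 'a set \<Rightarrow> bool" where
  "holomorphic_map_on F S \<longleftrightarrow> (\<forall>x\<in>S. \<exists>L. bounded_clinear L \<and> (F has_derivative L) (at x))"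

(* The Frechet derivative as an element of the normed space of bounded (real-)linear operators, so
   that it can be iterated: the n-fold iterate is the n-th Frechet derivative, an n-linear operator
   in curried form. At points where a complex-linear derivative exists, uniqueness of the real
   Frechet derivative makes the two agree. *)

definition frechet_D ::
    "('a::real_normed_vector \<Rightarrow> 'b::real_normed_vector) \<Rightarrow> 'a \<Rightarrow> ('a \<Rightarrow>\<^sub>L 'b)" where
  "frechet_D f x = Blinfun (frechet_derivative f (at x))"

lemma blinfun_apply_frechet_D:
  assumes "(f has_derivative L) (at x)"
  shows "blinfun_apply (frechet_D f x) = L"
  using assms frechet_derivative_at[OF assms]
  by (simp add: frechet_D_def bounded_linear_Blinfun_apply has_derivative_bounded_linear)

definition support_functionals :: "'a::complex_banach \<Rightarrow> ('a \<Rightarrow> complex) set" where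
  "support_functionals x =
     {T. bounded_clinear T \<and> T x = complex_of_real (norm x) \<and> onorm T = 1}"

definition normalized_map :: "('a::complex_banach \<Rightarrow> 'a) \<Rightarrow> bool" where
  "normalized_map F \<longleftrightarrow> F 0 = 0 \<and> frechet_D F 0 = id_blinfun"

definition locally_biholomorphic :: "('a::complex_banach \<Rightarrow> 'a) \<Rightarrow> bool" where
  "locally_biholomorphic F \<longleftrightarrow> holomorphic_map_on F (ball 0 1) \<and>
     (\<forall>x\<in>ball 0 1. \<exists>L. L o\<^sub>L frechet_D F x = id_blinfun \<and> frechet_D F x o\<^sub>L L = id_blinfun)"

(* Intended for \<bar>\<beta>\<bar> < pi / 2. *)

definition spirallike :: "real \<Rightarrow> ('a::complex_banach \<Rightarrow> 'a) set" where
  "spirallike \<beta> = {F. normalized_map F \<and> locally_biholomorphic F \<and>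
     (\<forall>x\<in>ball 0 1 - {0}. \<forall>T\<in>support_functionals x.
        Re (exp (- \<i> * complex_of_real \<beta>) * T (inv (blinfun_apply (frechet_D F x)) (F x))) > 0)}"

definition A2 :: "('a::complex_banach \<Rightarrow> 'a) \<Rightarrow> 'a \<Rightarrow> ('a \<Rightarrow> complex) \<Rightarrow> complex" where
  "A2 F x0 T = 1 / fact 2 *
     T (blinfun_apply (blinfun_apply (frechet_D (frechet_D F) 0) x0) x0)"

definition A3 :: "('a::complex_banach \<Rightarrow> 'a) \<Rightarrow> 'a \<Rightarrow> ('a \<Rightarrow> complex) \<Rightarrow> complex" where
  "A3 F x0 T = 1 / fact 3 *
     T (blinfun_apply (blinfun_apply (blinfun_apply
          (frechet_D (frechet_D (frechet_D F)) 0) x0) x0) x0)"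

definition A4 :: "('a::complex_banach \<Rightarrow> 'a) \<Rightarrow> 'a \<Rightarrow> ('a \<Rightarrow> complex) \<Rightarrow> complex" where
  "A4 F x0 T = 1 / fact 4 *
     T (blinfun_apply (blinfun_apply (blinfun_apply (blinfun_apply
          (frechet_D (frechet_D (frechet_D (frechet_D F))) 0) x0) x0) x0) x0)"

definition H22 :: "('a::complex_banach \<Rightarrow> 'a) \<Rightarrow> 'a \<Rightarrow> ('a \<Rightarrow> complex) \<Rightarrow> complex" where
  "H22 F x0 T = A2 F x0 T * A4 F x0 T - (A3 F x0 T)\<^sup>2"

end

theory Submission
  imports Defs
begin

text \<open>
  On the complex line through \<open>x\<^sub>0\<close> the map is \<open>F(z x\<^sub>0) = f(z) x\<^sub>0\<close> with \<open>f(z) = z g(z x\<^sub>0)\<close>,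
  so \<open>f\<close> is a \<open>\<beta>\<close>-spirallike function of one variable and the numbers \<open>A\<^sub>n\<close> are its Taylor
  coefficients. With \<open>\<tau> = exp(-i\<beta>) cos \<beta>\<close> and \<open>z \<phi>(z)\<close> the Schwarz function of \<open>f\<close>,
  \<open>\<phi>(z) = w\<^sub>0 + w\<^sub>1 z + w\<^sub>2 z\<^sup>2 + \<dots>\<close>, one computes
  \<open>A\<^sub>2 A\<^sub>4 - A\<^sub>3\<^sup>2 = \<tau>\<^sup>2 / 3 (4 w\<^sub>0 w\<^sub>2 + 2 w\<^sub>0\<^sup>2 w\<^sub>1 - 3 w\<^sub>1\<^sup>2 + (1 - 4 \<tau>\<^sup>2) w\<^sub>0\<^sup>4)\<close>,
  and two steps of Schur's algorithm together with \<open>\<bar>1 - 4 \<tau>\<^sup>2\<bar> \<le> 3\<close> bound the bracket by \<open>3\<close>.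
  Equality holds for \<open>\<phi>(z) = z\<close>, that is \<open>F(x) = (1 - T(x)\<^sup>2) powr (-\<tau>) x\<close>, where the
  support functional \<open>T\<close> comes from Hahn-Banach.

  The Taylor coefficients make sense because the Frechet derivative of a holomorphic map is again
  holomorphic. This is reduced by norming functionals to Cauchy estimates on complex lines.
\<close>

section \<open>The Hahn-Banach theorem\<close>

text \<open>Homogeneity is asked only as an inequality for positive factors, which is easy to verify
  for infima; using the factor \<open>1/c\<close> as well turns it into equality.\<close>

definition sublinear :: "('a::real_vector \<Rightarrow> real) \<Rightarrow> bool" where
  "sublinear q \<longleftrightarrow> (\<forall>x y. q (x + y) \<le> q x + q y) \<and> (\<forall>c>0. \<forall>x. q (c *\<^sub>R x) \<le> c * q x)"

lemma sublinear_add: "sublinear q \<Longrightarrow> q (x + y) \<le> q x + q y"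
  by (simp add: sublinear_def)

lemma sublinear_zero:
  assumes "sublinear q" shows "q 0 = 0"
proof -
  have "q (c *\<^sub>R 0) \<le> c * q 0" if "c > 0" for c
    using assms that unfolding sublinear_def by blast
  \<comment> \<open>The factor 2 gives \<open>0 \<le> q 0\<close>, the factor 1/2 gives
    \<open>q 0 \<le> 0\<close>.\<close>
  from this[of 2] this[of "1/2"] show ?thesis by simp
qed

lemma sublinear_scaleR:
  assumes "sublinear q" "c \<ge> 0" shows "q (c *\<^sub>R x) = c * q x"
proof (cases "c = 0")
  case True then show ?thesis using sublinear_zero[OF assms(1)] by simp
next
  case False
  then have c: "c > 0" using assms by simp
  have "q ((1/c) *\<^sub>R (c *\<^sub>R x)) \<le> (1/c) * q (c *\<^sub>R x)"
    using assms c unfolding sublinear_def by (metis zero_less_divide_1_iff)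
  then have "c * q x \<le> q (c *\<^sub>R x)" using c by (simp add: field_simps)
  then show ?thesis using assms c unfolding sublinear_def by (meson order_antisym)
qed

text \<open>Serves both infima below, over the shifts in \<open>slide\<close> and over a chain in
  Zorn's lemma. Subadditivity is inherited as soon as any two indices \<open>i\<close>,
  \<open>j\<close> can be merged into one index \<open>k\<close>; the lower bounds keep the real
  \<open>INF\<close> meaningful.\<close>

lemma sublinear_INF:
  fixes f :: "'i \<Rightarrow> 'a::real_vector \<Rightarrow> real"
  assumes ne: "I \<noteq> {}"
    and bdd: "\<And>x. \<exists>m. \<forall>i\<in>I. m \<le> f i x"
    and add: "\<And>i j x y. i \<in> I \<Longrightarrow> j \<in> I \<Longrightarrow> \<exists>k\<in>I. f k (x + y) \<le> f i x + f j y"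
    and scale: "\<And>c i x. c > 0 \<Longrightarrow> i \<in> I \<Longrightarrow> \<exists>k\<in>I. f k (c *\<^sub>R x) \<le> c * f i x"
  shows "sublinear (\<lambda>x. INF i\<in>I. f i x)"
proof -
  let ?u = "\<lambda>x. INF i\<in>I. f i x"
  have bd: "bdd_below ((\<lambda>i. f i x) ` I)" for x
    using bdd[of x] by (auto simp: bdd_below_def)
  have le: "?u x \<le> f i x" if "i \<in> I" for i x
    using bd that by (rule cINF_lower)
  have "?u (x + y) \<le> ?u x + ?u y" for x y
  proof -
    \<comment> \<open>The infimum is taken over \<open>i\<close> with \<open>j\<close> fixed, and
      afterwards over \<open>j\<close>.\<close>
    have "?u (x + y) - f j y \<le> f i x" if "i \<in> I" "j \<in> I" for i j
      using add[OF that, of x y] le[of _ "x + y"] by force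
    then have "?u (x + y) - f j y \<le> ?u x" if "j \<in> I" for j
      using ne that by (intro cINF_greatest) auto
    then have "?u (x + y) - ?u x \<le> f j y" if "j \<in> I" for j
      using that by (simp add: algebra_simps)
    then have "?u (x + y) - ?u x \<le> ?u y" using ne by (intro cINF_greatest) auto
    then show ?thesis by simp
  qed
  moreover have "?u (c *\<^sub>R x) \<le> c * ?u x" if c: "c > 0" for c x
  proof -
    have "?u (c *\<^sub>R x) / c \<le> f i x" if "i \<in> I" for i
      using scale[OF c that, of x] le[of _ "c *\<^sub>R x"] c by (force simp: field_simps)
    then have "?u (c *\<^sub>R x) / c \<le> ?u x" using ne by (intro cINF_greatest) auto
    then show ?thesis using c by (simp add: field_simps)
  qed
  ultimately show ?thesis by (simp add: sublinear_def)
qed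

text \<open>Minimal sublinear functionals are linear: \<open>slide p y\<close> lies below \<open>p\<close>, so it equals a minimal
  \<open>p\<close>, which makes \<open>p\<close> additive.\<close>

definition slide :: "('a::real_vector \<Rightarrow> real) \<Rightarrow> 'a \<Rightarrow> 'a \<Rightarrow> real" where
  "slide p y x = (INF t\<in>{0..}. p (x + t *\<^sub>R y) - t * p y)"

text \<open>Subadditivity at \<open>t *\<^sub>R y = (x + t *\<^sub>R y) + (- x)\<close>. The bound
  does not depend on \<open>t\<close>, so the infimum in \<open>slide\<close> is finite.\<close>

lemma slide_lower:
  assumes p: "sublinear p" and "t \<ge> 0"
  shows "- p (- x) \<le> p (x + t *\<^sub>R y) - t * p y"
  using sublinear_add[OF p, of "x + t *\<^sub>R y" "- x"] sublinear_scaleR[OF p \<open>t \<ge> 0\<close>, of y] by simp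

lemma slide_le:
  assumes "sublinear p" and "t \<ge> 0"
  shows "slide p y x \<le> p (x + t *\<^sub>R y) - t * p y"
  unfolding slide_def using assms slide_lower[OF assms(1)]
  by (intro cINF_lower) (auto simp: bdd_below_def)

lemma sublinear_slide:
  assumes p: "sublinear p"
  shows "sublinear (slide p y)"
  unfolding slide_def
proof (rule sublinear_INF)
  fix i j :: real and x z :: 'a assume "i \<in> {0..}" "j \<in> {0..}"
  then show "\<exists>k\<in>{0..}. p (x + z + k *\<^sub>R y) - k * p y
      \<le> (p (x + i *\<^sub>R y) - i * p y) + (p (z + j *\<^sub>R y) - j * p y)"
    using sublinear_add[OF p, of "x + i *\<^sub>R y" "z + j *\<^sub>R y"]
    by (intro bexI[of _ "i + j"]) (auto simp: algebra_simps)
next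
  fix c i :: real and x :: 'a assume "c > 0" "i \<in> {0..}"
  then show "\<exists>k\<in>{0..}. p (c *\<^sub>R x + k *\<^sub>R y) - k * p y \<le> c * (p (x + i *\<^sub>R y) - i * p y)"
    using sublinear_scaleR[OF p, of c "x + i *\<^sub>R y"]
    by (intro bexI[of _ "c * i"]) (auto simp: algebra_simps)
qed (use slide_lower[OF p] in auto)

lemma minimal_sublinear_additive:
  assumes p: "sublinear p" and min: "\<And>q. sublinear q \<Longrightarrow> (\<And>x. q x \<le> p x) \<Longrightarrow> q = p"
  shows "p (x + y) = p x + p y"
proof -
  \<comment> \<open>The shift \<open>t = 0\<close> puts \<open>slide p y\<close> below
    \<open>p\<close>, so minimality gives equality; \<open>t = 1\<close> then yields the missing
    half of additivity.\<close>
  have "slide p y = p"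
    using slide_le[OF p, of 0 y] by (intro min sublinear_slide p) auto
  then have "p x \<le> p (x + y) - p y" using slide_le[OF p, of 1 y x] by simp
  then show ?thesis using sublinear_add[OF p, of x y] by simp
qed

text \<open>Zorn's lemma for the reversed pointwise order \<open>P\<close>, whose maximal elements
  are minimal functionals; a nonempty chain is bounded by its pointwise infimum.\<close>

lemma ex_minimal_sublinear:
  assumes q: "sublinear q"
  shows "\<exists>p. sublinear p \<and> (\<forall>x. p x \<le> q x) \<and> (\<forall>r. sublinear r \<longrightarrow> (\<forall>x. r x \<le> p x) \<longrightarrow> r = p)"
proof -
  define A where "A = {p. sublinear p \<and> (\<forall>x. p x \<le> q x)}"
  define P where "P = (\<lambda>p r :: 'a \<Rightarrow> real. r \<le> p)"
  have "\<exists>m\<in>A. \<forall>a\<in>A. P m a \<longrightarrow> a = m"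
  proof (rule predicate_Zorn)
    show "partial_order_on A (relation_of P A)"
      by (rule partial_order_on_relation_ofI) (auto simp: P_def)
  next
    fix C assume C: "C \<in> Chains (relation_of P A)"
    then have CA: "C \<subseteq> A" and tot: "\<And>p r. p \<in> C \<Longrightarrow> r \<in> C \<Longrightarrow> p \<le> r \<or> r \<le> p"
      by (auto simp: Chains_def relation_of_def P_def)
    show "\<exists>u\<in>A. \<forall>a\<in>C. P a u"
    proof (cases "C = {}")
      case True
      then show ?thesis using q by (auto simp: A_def)
    next
      case False
      \<comment> \<open>From \<open>0 = p 0 \<le> p x + p (- x)\<close>: one lower bound for the
        whole chain.\<close>
      have low: "- q (- x) \<le> p x" if "p \<in> C" for p x
      proof -
        have "sublinear p" "p (- x) \<le> q (- x)" using that CA by (auto simp: A_def)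
        then show ?thesis using sublinear_add[of p x "- x"] sublinear_zero[of p] by simp
      qed
      define u where "u x = (INF p\<in>C. p x)" for x
      have ule: "u x \<le> p x" if "p \<in> C" for p x
        unfolding u_def using that low by (intro cINF_lower) (auto simp: bdd_below_def)
      have "sublinear u" unfolding u_def
      proof (rule sublinear_INF)
        \<comment> \<open>Of two members of the chain the smaller one serves as
          \<open>k\<close>.\<close>
        fix i j x y assume ij: "i \<in> C" "j \<in> C"
        then have "i \<le> j \<or> j \<le> i" "sublinear i" "sublinear j" using tot CA by (auto simp: A_def)
        then show "\<exists>k\<in>C. k (x + y) \<le> i x + j y"
          using ij sublinear_add[of i x y] sublinear_add[of j x y]
          by (metis add_mono_thms_linordered_semiring(2,3) le_funD order_trans)
      next
        fix c :: real and i x assume "c > 0" "i \<in> C"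
        then show "\<exists>k\<in>C. k (c *\<^sub>R x) \<le> c * i x" using CA by (auto simp: A_def sublinear_def)
      qed (use low False in blast)+
      moreover obtain p where "p \<in> C" using False by blast
      ultimately have "u \<in> A" using ule[of p] CA by (force simp: A_def intro: order_trans)
      then show ?thesis using ule by (auto simp: P_def le_fun_def)
    qed
  qed
  then obtain m where m: "m \<in> A" "\<And>a. a \<in> A \<Longrightarrow> a \<le> m \<Longrightarrow> a = m" by (auto simp: P_def)
  have "r = m" if "sublinear r" "\<forall>x. r x \<le> m x" for r
    using that m by (intro m(2)) (auto simp: A_def le_fun_def intro: order_trans)
  then show ?thesis using m(1) by (auto simp: A_def)
qed

text \<open>A minimal sublinear functional below \<open>q\<close> works: it is additive, hence odd,
  and oddness extends homogeneity to negative scalars.\<close>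

lemma Hahn_Banach_sublinear:
  assumes q: "sublinear q"
  shows "\<exists>u. linear u \<and> (\<forall>x. u x \<le> q x)"
proof -
  obtain p where p: "sublinear p" and le: "\<forall>x. p x \<le> q x"
    and min: "\<forall>r. sublinear r \<longrightarrow> (\<forall>x. r x \<le> p x) \<longrightarrow> r = p"
    using ex_minimal_sublinear[OF q] by blast
  have add: "p (x + y) = p x + p y" for x y
    using min by (intro minimal_sublinear_additive p) auto
  have neg: "p (- x) = - p x" for x
    using add[of x "- x"] sublinear_zero[OF p] by simp
  have "p (c *\<^sub>R x) = c * p x" for c x
    using sublinear_scaleR[OF p, of c x] sublinear_scaleR[OF p, of "- c" x] neg[of "c *\<^sub>R x"]
    by (cases "c \<ge> 0") auto
  then have "linear p" using add by (intro linearI) auto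
  then show ?thesis using le by blast
qed

text \<open>Dominating by \<open>slide norm v\<close> instead of the norm builds the value at
  \<open>v\<close> into the bound: the shift \<open>t = 1\<close> gives
  \<open>slide norm v (- v) \<le> - norm v\<close>.\<close>

lemma Hahn_Banach_norming:
  fixes v :: "'a::real_normed_vector"
  shows "\<exists>u. linear u \<and> (\<forall>x. u x \<le> norm x) \<and> u v = norm v"
proof -
  have n: "sublinear (norm :: 'a \<Rightarrow> real)"
    by (auto simp: sublinear_def norm_triangle_ineq)
  obtain u where u: "linear u" "\<forall>x. u x \<le> slide norm v x"
    using Hahn_Banach_sublinear[OF sublinear_slide[OF n]] by blast
  have le: "u x \<le> norm x" for x
    using u(2) slide_le[OF n, of 0 v x] by (auto intro: order_trans)
  have "u (- v) \<le> - norm v"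
    using u(2)[rule_format, of "- v"] slide_le[OF n, of 1 v "- v"] by simp
  then have "u v = norm v" using le[of v] linear_neg[OF u(1), of v] by simp
  then show ?thesis using u(1) le by blast
qed

section \<open>Complex scalars and norming functionals\<close>

lemma scaleC_one [simp]: "1 *\<^sub>C (x::'a::complex_banach) = x"
  using scaleC_of_real[of 1 x] by simp

lemma scaleC_zero_left [simp]: "0 *\<^sub>C (x::'a::complex_banach) = 0"
  using scaleC_of_real[of 0 x] by simp

lemma scaleC_zero_right [simp]: "c *\<^sub>C (0::'a::complex_banach) = 0"
  using norm_scaleC[of c "0::'a"] by simp

lemma scaleC_minus_left: "(- c) *\<^sub>C (x::'a::complex_banach) = - (c *\<^sub>C x)"
  using scaleC_add_left[of c "- c" x] by (simp add: eq_neg_iff_add_eq_0 add.commute)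

lemma scaleC_minus_right: "c *\<^sub>C (- x) = - (c *\<^sub>C (x::'a::complex_banach))"
  using scaleC_add_right[of c x "- x"] by (simp add: eq_neg_iff_add_eq_0 add.commute)

lemma scaleC_diff_right: "c *\<^sub>C (x - y) = c *\<^sub>C x - c *\<^sub>C (y::'a::complex_banach)"
  using scaleC_add_right[of c x "- y"] by (simp add: scaleC_minus_right)

lemma scaleR_scaleC: "r *\<^sub>R (x::'a::complex_banach) = complex_of_real r *\<^sub>C x"
  by (simp add: scaleC_of_real)

lemma scaleC_complex [simp]: "c *\<^sub>C (z::complex) = c * z"
  by (simp add: scaleC_complex_def)

lemma scaleC_eq_0_iff [simp]: "c *\<^sub>C (x::'a::complex_banach) = 0 \<longleftrightarrow> c = 0 \<or> x = 0"
  by (metis norm_scaleC mult_eq_0_iff norm_eq_zero)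

lemma bounded_clinearI:
  fixes L :: "'a::complex_banach \<Rightarrow> 'b::complex_banach"
  assumes "\<And>x y. L (x + y) = L x + L y" "\<And>c x. L (c *\<^sub>C x) = c *\<^sub>C L x"
    "\<And>x. norm (L x) \<le> norm x * K"
  shows "bounded_clinear L"
  unfolding bounded_clinear_def using assms
  by (auto intro!: bounded_linear_intro simp: scaleR_scaleC)

lemma
  assumes "bounded_clinear L"
  shows bounded_clinear_imp_bounded_linear: "bounded_linear L"
    and bounded_clinear_scaleC: "L (c *\<^sub>C x) = c *\<^sub>C L x"
  using assms by (auto simp: bounded_clinear_def)

lemma support_functionals_bound:
  assumes "T \<in> support_functionals x"
  shows "cmod (T y) \<le> norm y"
  using assms onorm[of T y] by (simp add: support_functionals_def bounded_clinear_def)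

text \<open>The complex Hahn-Banach theorem: a real linear \<open>u\<close> is the real part of the
  complex linear \<open>u x - i u(i x)\<close>, and rotating \<open>x\<close> transfers the bound
  from the real part to the modulus.\<close>

lemma norming_functional:
  fixes v :: "'a::complex_banach"
  shows "\<exists>T. bounded_clinear T \<and> (\<forall>x. cmod (T x) \<le> norm x) \<and> T v = complex_of_real (norm v)"
proof -
  obtain u where u: "linear u" "\<And>x. u x \<le> norm x" "u v = norm v"
    using Hahn_Banach_norming[of v] by blast
  define T where "T x = Complex (u x) (- u (\<i> *\<^sub>C x))" for x :: 'a
  have add: "T (x + y) = T x + T y" for x y
    by (simp add: T_def scaleC_add_right linear_add[OF u(1)] complex_eq_iff)
  have sc: "T (c *\<^sub>C x) = c * T x" for c x
  proof -
    have *: "c *\<^sub>C x = Re c *\<^sub>R x + Im c *\<^sub>R (\<i> *\<^sub>C x)" for c and x :: 'a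
      by (simp add: scaleR_scaleC scaleC_scaleC flip: scaleC_add_left)
         (metis complex_eq mult.commute)
    have ii: "\<i> *\<^sub>C \<i> *\<^sub>C x = - x" by (simp add: scaleC_scaleC scaleC_minus_left)
    have "\<i> *\<^sub>C c *\<^sub>C x = Re c *\<^sub>R (\<i> *\<^sub>C x) + Im c *\<^sub>R (\<i> *\<^sub>C (\<i> *\<^sub>C x))"
      using *[of c "\<i> *\<^sub>C x"] by (simp add: scaleC_scaleC mult.commute)
    then have ic: "u (\<i> *\<^sub>C c *\<^sub>C x) = Re c * u (\<i> *\<^sub>C x) - Im c * u x"
      by (simp add: ii linear_diff[OF u(1)] linear_scale[OF u(1)])
    have "u (c *\<^sub>C x) = Re c * u x + Im c * u (\<i> *\<^sub>C x)"
      by (subst *) (simp add: linear_add[OF u(1)] linear_scale[OF u(1)])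
    then show ?thesis unfolding T_def
      by (simp add: ic linear_add[OF u(1)] linear_diff[OF u(1)] linear_scale[OF u(1)] complex_eq_iff algebra_simps)
  qed
  have le: "cmod (T x) \<le> norm x" for x
  proof (cases "T x = 0")
    case False
    \<comment> \<open>A unimodular factor making \<open>c * T x\<close> real, so that
      \<open>u\<close> alone sees it.\<close>
    define c where "c = cnj (T x) / cmod (T x)"
    have "c * T x = complex_of_real (cmod (T x))"
      using False by (simp add: c_def complex_norm_square[symmetric] power2_eq_square mult.commute)
    then have "T (c *\<^sub>C x) = complex_of_real (cmod (T x))" by (simp add: sc)
    then have "cmod (T x) = u (c *\<^sub>C x)" by (simp add: T_def complex_eq_iff)
    also have "\<dots> \<le> norm (c *\<^sub>C x)" by (rule u)
    also have "\<dots> = norm x" using False by (simp add: norm_scaleC c_def norm_divide)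
    finally show ?thesis .
  qed simp
  \<comment> \<open>\<open>Re (T v) = norm v\<close> already exhausts the bound on
    \<open>cmod (T v)\<close> and leaves no room for an imaginary part.\<close>
  have "(Im (T v))\<^sup>2 \<le> 0"
    using le[of v] u(3) power_mono[OF le[of v], of 2] by (simp add: cmod_power2 T_def)
  then have "T v = complex_of_real (norm v)"
    using u(3) by (simp add: complex_eq_iff T_def)
  moreover have "bounded_clinear T"
    using add sc le by (intro bounded_clinearI[where K = 1]) auto
  ultimately show ?thesis using le by blast
qed

lemma support_functional_exists:
  fixes x :: "'a::complex_banach"
  assumes "x \<noteq> 0"
  shows "support_functionals x \<noteq> {}"
proof -
  obtain T where T: "bounded_clinear T" "\<And>y. cmod (T y) \<le> norm y" "T x = complex_of_real (norm x)"
    using norming_functional[of x] by blast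
  have "onorm T \<le> 1" using T(2) by (intro onorm_bound) auto
  moreover have "norm (T x) \<le> onorm T * norm x"
    using T(1) by (intro onorm) (auto simp: bounded_clinear_def)
  ultimately have "onorm T = 1" using T(3) assms by auto
  then show ?thesis using T by (auto simp: support_functionals_def)
qed

section \<open>Holomorphic maps between complex Banach spaces\<close>

lemma bounded_linear_scaleC: "bounded_linear (\<lambda>x::'a::complex_banach. c *\<^sub>C x)"
  by (rule bounded_linear_intro[where K = "cmod c"])
     (auto simp: scaleC_add_right scaleR_scaleC scaleC_scaleC norm_scaleC mult.commute)

lemma bounded_linear_scaleC_left: "bounded_linear (\<lambda>c. c *\<^sub>C (x::'a::complex_banach))"
  by (rule bounded_linear_intro[where K = "norm x"])
     (auto simp: scaleC_add_left scaleR_scaleC scaleC_scaleC norm_scaleC scaleR_conv_of_real)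

text \<open>With this instance \<open>frechet_D F\<close> is itself a map into a complex Banach
  space, so holomorphy makes sense for it and differentiation can be iterated.\<close>

instantiation blinfun :: (real_normed_vector, complex_banach) complex_banach
begin

definition scaleC_blinfun :: "complex \<Rightarrow> ('a \<Rightarrow>\<^sub>L 'b) \<Rightarrow> 'a \<Rightarrow>\<^sub>L 'b" where
  "scaleC_blinfun c L = Blinfun (\<lambda>x. c *\<^sub>C blinfun_apply L x)"

lemma blinfun_apply_scaleC [simp]: "blinfun_apply (c *\<^sub>C L) x = c *\<^sub>C blinfun_apply L x"
  unfolding scaleC_blinfun_def
  by (subst bounded_linear_Blinfun_apply)
     (auto intro!: bounded_linear_compose[OF bounded_linear_scaleC] blinfun.bounded_linear_right)

instance
proof
  fix a b :: complex and r :: real and x y :: "'a \<Rightarrow>\<^sub>L 'b"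
  show "a *\<^sub>C (x + y) = a *\<^sub>C x + a *\<^sub>C y"
    by (rule blinfun_eqI) (simp add: blinfun.add_left scaleC_add_right)
  show "(a + b) *\<^sub>C x = a *\<^sub>C x + b *\<^sub>C x"
    by (rule blinfun_eqI) (simp add: blinfun.add_left scaleC_add_left)
  show "a *\<^sub>C b *\<^sub>C x = (a * b) *\<^sub>C x"
    by (rule blinfun_eqI) (simp add: scaleC_scaleC)
  show "complex_of_real r *\<^sub>C x = r *\<^sub>R x"
    by (rule blinfun_eqI) (simp add: scaleC_of_real blinfun.scaleR_left)
  have le: "norm (c *\<^sub>C z) \<le> cmod c * norm z" for c and z :: "'a \<Rightarrow>\<^sub>L 'b"
    by (rule norm_blinfun_bound)
       (auto simp: norm_scaleC mult.assoc intro!: mult_left_mono norm_blinfun)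
  show "norm (a *\<^sub>C x) = cmod a * norm x"
  proof (cases "a = 0")
    case False
    have "inverse a *\<^sub>C (a *\<^sub>C x) = x"
      by (rule blinfun_eqI) (simp add: scaleC_scaleC False)
    \<comment> \<open>The reverse inequality is \<open>le\<close> applied to the scalar
      \<open>inverse a\<close>.\<close>
    then have "norm x \<le> cmod (inverse a) * norm (a *\<^sub>C x)" using le by metis
    then have "cmod a * norm x \<le> norm (a *\<^sub>C x)"
      using False by (simp add: norm_inverse norm_divide field_simps)
    then show ?thesis using le[of a x] by simp
  next
    case True
    have "0 *\<^sub>C x = 0" by (rule blinfun_eqI) simp
    then show ?thesis using True by simp
  qed
qed

end

lemma bounded_clinear_diff:
  "bounded_clinear f \<Longrightarrow> bounded_clinear g \<Longrightarrow> bounded_clinear (\<lambda>x. f x - g x)"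
  by (simp add: bounded_clinear_def bounded_linear_sub scaleC_diff_right)

lemma bounded_clinear_scaleR:
  assumes "bounded_clinear f"
  shows "bounded_clinear (\<lambda>x. r *\<^sub>R f x)"
  using assms bounded_linear_compose[OF bounded_linear_scaleR_right, of f r]
  by (auto simp: bounded_clinear_def scaleR_scaleC scaleC_scaleC mult.commute)

lemma bounded_clinear_frechet_D:
  assumes "holomorphic_map_on F S" "x \<in> S"
  shows "bounded_clinear (blinfun_apply (frechet_D F x))"
    and "(F has_derivative blinfun_apply (frechet_D F x)) (at x)"
  using assms blinfun_apply_frechet_D[of F _ x] by (force simp: holomorphic_map_on_def)+

lemma frechet_D_scaleC:
  assumes "holomorphic_map_on F S" "x \<in> S"
  shows "blinfun_apply (frechet_D F x) (c *\<^sub>C h) = c *\<^sub>C blinfun_apply (frechet_D F x) h"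
  using bounded_clinear_frechet_D(1)[OF assms] by (rule bounded_clinear_scaleC)

lemma frechet_D_eq:
  assumes "(F has_derivative L) (at x)"
  shows "frechet_D F x = Blinfun L"
  using blinfun_apply_frechet_D[OF assms] by (metis blinfun_apply_inverse)

lemma holomorphic_map_on_subset:
  "holomorphic_map_on F S \<Longrightarrow> A \<subseteq> S \<Longrightarrow> holomorphic_map_on F A"
  by (auto simp: holomorphic_map_on_def)

text \<open>Complex linearity of \<open>L\<close> and \<open>T\<close> upgrades the real chain rule
  to a complex derivative. The Cauchy and Taylor estimates in Banach spaces rest on this restriction
  to complex lines.\<close>

lemma has_field_derivative_along_line:
  fixes F :: "'a::complex_banach \<Rightarrow> 'b::complex_banach"
  assumes F: "(F has_derivative L) (at (x + z *\<^sub>C h))" and L: "bounded_clinear L"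
    and T: "bounded_clinear (T :: 'b \<Rightarrow> complex)"
  shows "((\<lambda>z. T (F (x + z *\<^sub>C h))) has_field_derivative T (L h)) (at z)"
proof -
  have "((\<lambda>z. x + z *\<^sub>C h) has_derivative (\<lambda>w. 0 + w *\<^sub>C h)) (at z)"
    by (intro has_derivative_add has_derivative_const
          bounded_linear_imp_has_derivative bounded_linear_scaleC_left)
  then have "((\<lambda>z. F (x + z *\<^sub>C h)) has_derivative (\<lambda>w. L (w *\<^sub>C h))) (at z)"
    using has_derivative_compose[of _ _ z UNIV F] F by simp
  then have "((\<lambda>z. T (F (x + z *\<^sub>C h))) has_derivative (\<lambda>w. T (L (w *\<^sub>C h)))) (at z)"
    using T bounded_linear.has_derivative by (auto simp: bounded_clinear_def)
  then show ?thesis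
    by (simp add: has_field_derivative_def bounded_clinear_scaleC[OF L] bounded_clinear_scaleC[OF T]
        mult.commute[of _ "T (L h)"])
qed

section \<open>Cauchy and Taylor estimates\<close>

lemma Cauchy_estimate_complex:
  assumes "f holomorphic_on ball 0 \<rho>" "\<rho> > 0" "\<And>z. z \<in> ball 0 \<rho> \<Longrightarrow> cmod (f z) \<le> M"
  shows "cmod (deriv f 0) \<le> 2 * M / \<rho>"
proof -
  \<comment> \<open>Half the radius leaves a closed disc on which \<open>f\<close> is continuous, at
    the cost of the factor 2.\<close>
  have "cmod ((deriv ^^ 1) f 0) \<le> fact 1 * M / (\<rho> / 2) ^ 1"
  proof (rule Cauchy_inequality)
    show "f holomorphic_on ball 0 (\<rho> / 2)"
      using assms by (auto elim!: holomorphic_on_subset)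
    show "continuous_on (cball 0 (\<rho> / 2)) f"
      using assms by (intro continuous_on_subset[OF holomorphic_on_imp_continuous_on]) auto
  qed (use assms in auto)
  then show ?thesis by (simp add: mult.commute)
qed

text \<open>Cauchy's inequality on discs of radius \<open>\<rho> / 2\<close> about points of the
  closed unit disc bounds the second derivative by \<open>2 M / (\<rho> / 2)^2\<close>; these discs
  stay inside because \<open>\<rho> > 2\<close>. Taylor's formula from 0 to 1 does the rest.\<close>

lemma Taylor_estimate_complex:
  assumes f: "f holomorphic_on ball 0 \<rho>" and "\<rho> > 2"
    and M: "\<And>z. z \<in> ball 0 \<rho> \<Longrightarrow> cmod (f z) \<le> M"
  shows "cmod (f 1 - f 0 - deriv f 0) \<le> 8 * M / \<rho>\<^sup>2"
proof -
  have "cmod ((deriv ^^ 2) f z) \<le> 8 * M / \<rho>\<^sup>2" if "z \<in> cball 0 1" for z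
  proof -
    have sub: "cball z (\<rho> / 2) \<subseteq> ball 0 \<rho>"
    proof
      fix w assume "w \<in> cball z (\<rho> / 2)"
      then show "w \<in> ball 0 \<rho>"
        using that \<open>\<rho> > 2\<close> norm_triangle_ineq2[of w z] by (auto simp: dist_norm norm_minus_commute)
    qed
    have "cmod ((deriv ^^ 2) f z) \<le> fact 2 * M / (\<rho> / 2) ^ 2"
    proof (rule Cauchy_inequality)
      show "f holomorphic_on ball z (\<rho> / 2)"
        using f sub by (meson ball_subset_cball holomorphic_on_subset)
      show "continuous_on (cball z (\<rho> / 2)) f"
        using f sub by (meson continuous_on_subset holomorphic_on_imp_continuous_on)
      fix w assume "cmod (z - w) = \<rho> / 2"
      then have "w \<in> cball z (\<rho> / 2)" by (simp add: dist_norm)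
      then show "cmod (f w) \<le> M" using sub M by blast
    qed (use \<open>\<rho> > 2\<close> in auto)
    then show ?thesis by (simp add: field_simps)
  qed
  then have "cmod ((deriv ^^ 0) f 1 - (\<Sum>i\<le>1. (deriv ^^ i) f 0 * (1 - 0) ^ i / fact i))
      \<le> 8 * M / \<rho>\<^sup>2 * cmod (1 - 0) ^ Suc 1 / fact 1"
  proof (intro complex_Taylor[where S = "cball 0 1"])
    fix i z assume "z \<in> cball (0::complex) 1"
    then have "((deriv ^^ i) f has_field_derivative deriv ((deriv ^^ i) f) z) (at z)"
      using f \<open>\<rho> > 2\<close>
      by (intro holomorphic_derivI[where S = "ball 0 \<rho>"] holomorphic_higher_deriv) auto
    then show "((deriv ^^ i) f has_field_derivative (deriv ^^ Suc i) f z) (at z within cball 0 1)"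
      by (auto intro: has_field_derivative_at_within)
  qed (auto simp: numeral_2_eq_2)
  then show ?thesis by (simp add: algebra_simps)
qed

lemma line_in_ball:
  assumes "z \<in> ball 0 (R / norm h)" "(h::'a::complex_banach) \<noteq> 0"
  shows "x + z *\<^sub>C h \<in> ball x R"
  using assms by (simp add: dist_norm norm_scaleC field_simps)

lemma holomorphic_on_line:
  fixes F :: "'a::complex_banach \<Rightarrow> 'b::complex_banach"
  assumes F: "holomorphic_map_on F (ball x R)" and h: "h \<noteq> 0"
    and T: "bounded_clinear (T :: 'b \<Rightarrow> complex)"
  shows "(\<lambda>z. T (F (x + z *\<^sub>C h))) holomorphic_on ball 0 (R / norm h)"
proof -
  have "(\<lambda>z. T (F (x + z *\<^sub>C h))) field_differentiable at z" if "z \<in> ball 0 (R / norm h)" for z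
    using has_field_derivative_along_line[OF _ _ T]
      bounded_clinear_frechet_D[OF F line_in_ball[OF that h]]
    unfolding field_differentiable_def by blast
  then show ?thesis
    by (simp add: holomorphic_on_def field_differentiable_at_within)
qed

lemma deriv_line:
  fixes F :: "'a::complex_banach \<Rightarrow> 'b::complex_banach"
  assumes F: "holomorphic_map_on F (ball x R)" and R: "R > 0"
    and T: "bounded_clinear (T :: 'b \<Rightarrow> complex)"
  shows "deriv (\<lambda>z. T (F (x + z *\<^sub>C h))) 0 = T (blinfun_apply (frechet_D F x) h)"
  using has_field_derivative_along_line[where F = F and x = x and z = 0 and h = h, OF _ _ T] bounded_clinear_frechet_D[OF F, of x] R
  by (intro DERIV_imp_deriv) simp

text \<open>A functional norming the vector \<open>?v\<close> reduces the claim to the scalar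
  estimate on the line \<open>x + z h\<close>, which stays in the ball for
  \<open>cmod z < R / norm h\<close>.\<close>

lemma Cauchy_estimate:
  fixes F :: "'a::complex_banach \<Rightarrow> 'b::complex_banach"
  assumes F: "holomorphic_map_on F (ball x R)" and R: "R > 0"
    and M: "\<And>y. y \<in> ball x R \<Longrightarrow> norm (F y) \<le> M"
  shows "norm (frechet_D F x) \<le> 2 * M / R"
proof (rule norm_blinfun_bound)
  show "0 \<le> 2 * M / R" using M[of x] R by (simp add: order_trans[OF norm_ge_zero])
  fix h
  let ?v = "blinfun_apply (frechet_D F x) h"
  show "norm ?v \<le> 2 * M / R * norm h"
  proof (cases "h = 0")
    case False
    obtain T where T: "bounded_clinear T" "\<And>y. cmod (T y) \<le> norm y" "T ?v = complex_of_real (norm ?v)"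
      using norming_functional[of ?v] by blast
    have "cmod (deriv (\<lambda>z. T (F (x + z *\<^sub>C h))) 0) \<le> 2 * M / (R / norm h)"
    proof (rule Cauchy_estimate_complex)
      show "(\<lambda>z. T (F (x + z *\<^sub>C h))) holomorphic_on ball 0 (R / norm h)"
        by (intro holomorphic_on_line F T False)
      fix z :: complex assume "z \<in> ball 0 (R / norm h)"
      then show "cmod (T (F (x + z *\<^sub>C h))) \<le> M"
        using T(2) M[OF line_in_ball[OF _ False]] order_trans by blast
    qed (use False R in auto)
    then show ?thesis using False R
      by (simp add: deriv_line[OF F R T(1)] T(3))
  qed (simp add: blinfun.zero_right)
qed

text \<open>The same reduction, now with a functional norming the Taylor remainder;
  \<open>z = 1\<close> corresponds to \<open>x + h\<close>, and \<open>norm h < R / 2\<close> makes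
  the radius \<open>R / norm h\<close> exceed 2.\<close>

lemma Taylor_estimate:
  fixes F :: "'a::complex_banach \<Rightarrow> 'b::complex_banach"
  assumes F: "holomorphic_map_on F (ball x R)" and R: "R > 0"
    and M: "\<And>y. y \<in> ball x R \<Longrightarrow> norm (F y) \<le> M"
    and h: "norm h < R / 2"
  shows "norm (F (x + h) - F x - blinfun_apply (frechet_D F x) h) \<le> 8 * M / R\<^sup>2 * (norm h)\<^sup>2"
    (is "norm ?v \<le> _")
proof (cases "h = 0")
  case False
  obtain T where T: "bounded_clinear T" "\<And>y. cmod (T y) \<le> norm y" "T ?v = complex_of_real (norm ?v)"
    using norming_functional[of ?v] by blast
  let ?f = "\<lambda>z. T (F (x + z *\<^sub>C h))"
  have "cmod (?f 1 - ?f 0 - deriv ?f 0) \<le> 8 * M / (R / norm h)\<^sup>2"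
  proof (rule Taylor_estimate_complex)
    show "?f holomorphic_on ball 0 (R / norm h)"
      by (intro holomorphic_on_line F T False)
    fix z :: complex assume "z \<in> ball 0 (R / norm h)"
    then show "cmod (T (F (x + z *\<^sub>C h))) \<le> M"
      using T(2) M[OF line_in_ball[OF _ False]] order_trans by blast
  qed (use False h R in \<open>auto simp: field_simps\<close>)
  moreover have "?f 1 - ?f 0 - deriv ?f 0 = T ?v"
    using T(1) by (simp add: deriv_line[OF F R T(1)] bounded_clinear_def bounded_linear.linear linear_diff)
  ultimately show ?thesis using False R T(3)
    by (simp add: power_divide)
qed (simp add: blinfun.zero_right)

lemma has_derivativeI_quadratic:
  fixes F :: "'a::real_normed_vector \<Rightarrow> 'b::real_normed_vector"
  assumes L: "bounded_linear L" and d: "\<delta> > 0"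
    and le: "\<And>h. norm h < \<delta> \<Longrightarrow> norm (F (x + h) - F x - L h) \<le> K * (norm h)\<^sup>2"
  shows "(F has_derivative L) (at x)"
  unfolding has_derivative_at
proof (intro conjI L)
  have lim: "((\<lambda>h. K * norm (h::'a)) \<longlongrightarrow> 0) (at 0)"
    by (intro tendsto_mult_right_zero tendsto_norm_zero tendsto_ident_at)
  have ev: "eventually (\<lambda>h::'a. norm h < \<delta>) (at 0)"
    using d by (auto simp: eventually_at dist_norm)
  show "((\<lambda>h. norm (F (x + h) - F x - L h) / norm h) \<longlongrightarrow> 0) (at 0)"
  proof (rule real_tendsto_sandwich[OF _ _ tendsto_const lim])
    show "\<forall>\<^sub>F h in at 0. norm (F (x + h) - F x - L h) / norm h \<le> K * norm h"
      using ev
    proof eventually_elim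
      case (elim h)
      show ?case
      proof (cases "h = 0")
        case False
        then show ?thesis using le[OF elim] by (simp add: divide_le_eq power2_eq_square mult.assoc)
      qed simp
    qed
  qed auto
qed

text \<open>In infinite dimensions a holomorphic map need not be bounded even on smaller closed
  balls, so bounds are taken only near a point, from continuity.\<close>

lemma holomorphic_map_locally_bounded:
  assumes "holomorphic_map_on F S" "open S" "x \<in> S"
  obtains R M where "R > 0" "ball x R \<subseteq> S" "\<And>y. y \<in> ball x R \<Longrightarrow> norm (F y) \<le> M"
proof -
  have "isCont F x"
    using bounded_clinear_frechet_D(2)[OF assms(1,3)] has_derivative_continuous by blast
  then obtain d where d: "d > 0" "\<And>y. dist y x < d \<Longrightarrow> dist (F y) (F x) < 1"
    unfolding continuous_at_eps_delta using zero_less_one by blast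
  obtain e where e: "e > 0" "ball x e \<subseteq> S" using openE[OF assms(2,3)] by blast
  show ?thesis
  proof (rule that[of "min d e" "norm (F x) + 1"])
    fix y assume "y \<in> ball x (min d e)"
    then have "dist (F y) (F x) < 1" using d(2)[of y] by (simp add: dist_commute[of x y])
    then show "norm (F y) \<le> norm (F x) + 1"
      using norm_triangle_ineq2[of "F y" "F x"] by (simp add: dist_norm)
  qed (use d e in auto)
qed

lemma holomorphic_map_diff:
  assumes "holomorphic_map_on f S" "holomorphic_map_on g S" "x \<in> S"
  shows "bounded_clinear (\<lambda>h. blinfun_apply (frechet_D f x) h - blinfun_apply (frechet_D g x) h)"
    and "((\<lambda>y. f y - g y) has_derivative
      (\<lambda>h. blinfun_apply (frechet_D f x) h - blinfun_apply (frechet_D g x) h)) (at x)"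
  using bounded_clinear_frechet_D[OF assms(1,3)] bounded_clinear_frechet_D[OF assms(2,3)]
  by (auto simp: bounded_clinear_def scaleC_diff_right bounded_linear_sub intro: has_derivative_diff)

text \<open>A Weierstrass convergence theorem at the centre of the ball: Cauchy's estimate on
  differences makes the derivatives converge, and the Taylor estimate, whose constant does not
  depend on \<open>n\<close>, passes to the limit.\<close>

lemma bounded_holomorphic_limit:
  fixes f :: "nat \<Rightarrow> 'a::complex_banach \<Rightarrow> 'b::complex_banach"
  assumes f: "\<And>n. holomorphic_map_on (f n) (ball x R)" and R: "R > 0"
    and M: "\<And>n y. y \<in> ball x R \<Longrightarrow> norm (f n y) \<le> M"
    and lim: "\<And>n y. y \<in> ball x R \<Longrightarrow> norm (f n y - G y) \<le> e n" and e: "e \<longlonglongrightarrow> 0"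
  shows "\<exists>L. bounded_clinear L \<and> (G has_derivative L) (at x)"
proof -
  have x: "x \<in> ball x R" using R by simp
  define d where "d n = frechet_D (f n) x" for n
  have dd: "norm (d m - d n) \<le> 2 * (e m + e n) / R" for m n
  proof -
    have "norm (frechet_D (\<lambda>y. f m y - f n y) x) \<le> 2 * (e m + e n) / R"
    proof (rule Cauchy_estimate[OF _ R])
      show "holomorphic_map_on (\<lambda>y. f m y - f n y) (ball x R)"
        using holomorphic_map_diff[OF f f] unfolding holomorphic_map_on_def by blast
      fix y assume "y \<in> ball x R"
      then show "norm (f m y - f n y) \<le> e m + e n"
        using lim[of y m] lim[of y n] norm_triangle_ineq4[of "f m y - G y" "f n y - G y"] by simp
    qed
    moreover have "frechet_D (\<lambda>y. f m y - f n y) x = d m - d n"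
      using blinfun_apply_frechet_D[OF holomorphic_map_diff(2)[OF f f x]]
      by (intro blinfun_eqI) (simp add: d_def blinfun.diff_left)
    ultimately show ?thesis by simp
  qed
  have "Cauchy d"
  proof (rule CauchyI)
    fix \<epsilon> :: real assume "\<epsilon> > 0"
    then have "eventually (\<lambda>n. e n < \<epsilon> * R / 4) sequentially"
      using e R by (intro order_tendstoD(2)[OF e]) auto
    then obtain N where N: "\<And>n. n \<ge> N \<Longrightarrow> e n < \<epsilon> * R / 4"
      by (auto simp: eventually_sequentially)
    have "norm (d m - d n) < \<epsilon>" if "m \<ge> N" "n \<ge> N" for m n
    proof -
      have "2 * (e m + e n) / R < \<epsilon>"
        using N[OF that(1)] N[OF that(2)] R by (simp add: field_simps)
      then show ?thesis using dd[of m n] by linarith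
    qed
    then show "\<exists>N. \<forall>m\<ge>N. \<forall>n\<ge>N. norm (d m - d n) < \<epsilon>" by blast
  qed
  then obtain L where L: "d \<longlonglongrightarrow> L" using convergent_eq_Cauchy by blast
  have Lh: "(\<lambda>n. blinfun_apply (d n) h) \<longlonglongrightarrow> blinfun_apply L h" for h
    by (intro blinfun.tendsto L tendsto_const)
  have "blinfun_apply L (c *\<^sub>C h) = c *\<^sub>C blinfun_apply L h" for c h
  proof (rule LIMSEQ_unique[OF Lh])
    show "(\<lambda>n. blinfun_apply (d n) (c *\<^sub>C h)) \<longlonglongrightarrow> c *\<^sub>C blinfun_apply L h"
      using bounded_linear.tendsto[OF bounded_linear_scaleC Lh]
      by (simp add: d_def frechet_D_scaleC[OF f x])
  qed
  then have "bounded_clinear (blinfun_apply L)"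
    by (simp add: bounded_clinear_def blinfun.bounded_linear_right)
  moreover have "(G has_derivative blinfun_apply L) (at x)"
  proof (rule has_derivativeI_quadratic)
    fix h :: 'a assume h: "norm h < R / 2"
    have G: "(\<lambda>n. f n y) \<longlonglongrightarrow> G y" if "y \<in> ball x R" for y
      by (rule LIM_zero_cancel, rule Lim_null_comparison[OF _ e]) (use lim[OF that] in auto)
    have "(\<lambda>n. norm (f n (x + h) - f n x - blinfun_apply (d n) h))
        \<longlonglongrightarrow> norm (G (x + h) - G x - blinfun_apply L h)"
      using h R by (intro tendsto_norm tendsto_diff G Lh) (auto simp: dist_norm)
    then show "norm (G (x + h) - G x - blinfun_apply L h) \<le> 8 * M / R\<^sup>2 * (norm h)\<^sup>2"
      by (rule LIMSEQ_le_const2) (use Taylor_estimate[OF f R M h] in \<open>auto simp: d_def\<close>)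
  qed (use R in \<open>auto intro: blinfun.bounded_linear_right\<close>)
  ultimately show ?thesis by blast
qed

lemma half_ball_subset:
  fixes x y :: "'a::metric_space"
  assumes "y \<in> ball x (R / 2)"
  shows "ball y (R / 2) \<subseteq> ball x R"
proof
  fix z assume "z \<in> ball y (R / 2)"
  then show "z \<in> ball x R" using assms dist_triangle[of x z y] by simp
qed

lemma frechet_D_bound:
  fixes F :: "'a::complex_banach \<Rightarrow> 'b::complex_banach"
  assumes F: "holomorphic_map_on F (ball x R)"
    and M: "\<And>y. y \<in> ball x R \<Longrightarrow> norm (F y) \<le> M" and y: "y \<in> ball x (R / 2)"
  shows "norm (frechet_D F y) \<le> 4 * M / R"
proof -
  have R: "R > 0" using le_less_trans[OF zero_le_dist, of x y "R / 2"] y by simp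
  have sub: "ball y (R / 2) \<subseteq> ball x R"
    using y by (rule half_ball_subset)
  have "norm (frechet_D F y) \<le> 2 * M / (R / 2)"
    by (rule Cauchy_estimate) (use R M sub holomorphic_map_on_subset[OF F sub] in auto)
  then show ?thesis by simp
qed

lemma holomorphic_map_lipschitz:
  fixes F :: "'a::complex_banach \<Rightarrow> 'b::complex_banach"
  assumes F: "holomorphic_map_on F (ball x R)"
    and M: "\<And>y. y \<in> ball x R \<Longrightarrow> norm (F y) \<le> M"
    and y: "y \<in> ball x (R / 2)" and z: "z \<in> ball x (R / 2)"
  shows "norm (F y - F z) \<le> 4 * M / R * norm (y - z)"
proof (rule differentiable_bound[where S = "ball x (R / 2)"])
  fix w assume w: "w \<in> ball x (R / 2)"
  then have "w \<in> ball x R" using le_less_trans[OF zero_le_dist, of x w "R / 2"] by simp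
  then show "(F has_derivative blinfun_apply (frechet_D F w)) (at w within ball x (R / 2))"
    using bounded_clinear_frechet_D(2)[OF F] has_derivative_at_withinI by blast
  show "onorm (blinfun_apply (frechet_D F w)) \<le> 4 * M / R"
    using frechet_D_bound[OF F M w] by (simp add: norm_blinfun.rep_eq)
qed (use y z in auto)

text \<open>The directional derivative \<open>DF(\<cdot>)k\<close> is the locally uniform limit of the holomorphic maps
  \<open>n (F(\<cdot> + k/n) - F(\<cdot>))\<close>.\<close>

lemma directional_derivative_differentiable_aux:
  fixes F :: "'a::complex_banach \<Rightarrow> 'b::complex_banach"
  assumes F: "holomorphic_map_on F (ball x R)"
    and M: "\<And>y. y \<in> ball x R \<Longrightarrow> norm (F y) \<le> M" and k: "norm k < R / 4"
  shows "\<exists>L. bounded_clinear L \<and> ((\<lambda>y. blinfun_apply (frechet_D F y) k) has_derivative L) (at x)"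
proof -
  have R: "R > 0" using le_less_trans[OF norm_ge_zero k] by simp
  \<comment> \<open>Since \<open>norm k < R / 4\<close>, these increments keep
    \<open>y + kn n\<close> in the half ball for every \<open>y\<close> in the quarter ball.\<close>
  define kn where "kn n = (1 / real (Suc n)) *\<^sub>R k" for n
  have nkn: "norm (kn n) = norm k / real (Suc n)" for n by (simp add: kn_def)
  have kn4: "norm (kn n) < R / 4" for n
  proof -
    have "norm k / real (Suc n) \<le> norm k"
      by (simp add: divide_le_eq mult_le_cancel_left1)
    then show ?thesis using k by (simp only: nkn)
  qed
  define f where "f n y = real (Suc n) *\<^sub>R (F (y + kn n) - F y)" for n y
  have in1: "y + kn n \<in> ball x (R / 2)" "y \<in> ball x (R / 2)" "y \<in> ball x R" "y + kn n \<in> ball x R"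
    if "y \<in> ball x (R / 4)" for n y
  proof -
    have "dist x (y + kn n) < R / 2"
      using that kn4[of n] norm_triangle_ineq4[of "x - y" "kn n"]
      by (simp add: dist_norm algebra_simps)
    then show "y + kn n \<in> ball x (R / 2)" "y \<in> ball x (R / 2)" "y \<in> ball x R" "y + kn n \<in> ball x R"
      using that R by auto
  qed
  show ?thesis
  proof (rule bounded_holomorphic_limit[where f = f and R = "R / 4" and M = "4 * M / R * norm k"
        and e = "\<lambda>n. 32 * M / R\<^sup>2 * (norm k)\<^sup>2 * (1 / real (Suc n))"])
    fix n
    show "holomorphic_map_on (f n) (ball x (R / 4))"
      unfolding holomorphic_map_on_def
    proof
      fix y assume y: "y \<in> ball x (R / 4)"
      let ?a = "blinfun_apply (frechet_D F (y + kn n))" and ?b = "blinfun_apply (frechet_D F y)"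
      note a = bounded_clinear_frechet_D[OF F in1(4)[OF y, of n]]
        and b = bounded_clinear_frechet_D[OF F in1(3)[OF y]]
      have "((\<lambda>y. F (y + kn n)) has_derivative ?a) (at y)"
        using has_derivative_compose[OF has_derivative_add[OF has_derivative_ident has_derivative_const], of F ?a y "kn n"] a(2)
        by simp
      then have "(f n has_derivative (\<lambda>h. real (Suc n) *\<^sub>R (?a h - ?b h))) (at y)"
        unfolding f_def by (intro has_derivative_scaleR_right has_derivative_diff b(2))
      moreover have "bounded_clinear (\<lambda>h. real (Suc n) *\<^sub>R (?a h - ?b h))"
        by (intro bounded_clinear_scaleR bounded_clinear_diff a b)
      ultimately show "\<exists>L. bounded_clinear L \<and> (f n has_derivative L) (at y)" by blast
    qed
    fix y assume y: "y \<in> ball x (R / 4)"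
    \<comment> \<open>The factor \<open>n + 1\<close> cancels against \<open>norm (kn n)\<close>,
      giving a bound independent of \<open>n\<close>.\<close>
    have "norm (F (y + kn n) - F y) \<le> 4 * M / R * norm (kn n)"
      using holomorphic_map_lipschitz[OF F M in1(1)[OF y] in1(2)[OF y], of n] by simp
    then have "real (Suc n) * norm (F (y + kn n) - F y) \<le> real (Suc n) * (4 * M / R * norm (kn n))"
      by (rule mult_left_mono) simp
    also have "\<dots> = 4 * M / R * norm k" by (simp add: nkn del: of_nat_Suc)
    finally show "norm (f n y) \<le> 4 * M / R * norm k" by (simp add: f_def del: of_nat_Suc)
    \<comment> \<open>The Taylor remainder is quadratic in \<open>kn n\<close>, so after
      multiplication by \<open>n + 1\<close> it is still of order
      \<open>1 / (n + 1)\<close>.\<close>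
    let ?r = "F (y + kn n) - F y - blinfun_apply (frechet_D F y) (kn n)"
    have sub: "ball y (R / 2) \<subseteq> ball x R"
      using in1(2)[OF y] by (rule half_ball_subset)
    have "norm ?r \<le> 8 * M / (R / 2)\<^sup>2 * (norm (kn n))\<^sup>2"
      by (rule Taylor_estimate)
         (use R M sub holomorphic_map_on_subset[OF F sub] kn4[of n] in auto)
    then have "real (Suc n) * norm ?r \<le> real (Suc n) * (8 * M / (R / 2)\<^sup>2 * (norm (kn n))\<^sup>2)"
      by (rule mult_left_mono) simp
    also have "\<dots> = 32 * M / R\<^sup>2 * (norm k)\<^sup>2 * (1 / real (Suc n))"
      by (simp add: nkn power2_eq_square del: of_nat_Suc)
    also have "real (Suc n) * norm ?r = norm (real (Suc n) *\<^sub>R ?r)" by (simp del: of_nat_Suc)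
    also have "real (Suc n) *\<^sub>R ?r = f n y - blinfun_apply (frechet_D F y) k"
      by (simp add: f_def kn_def blinfun.scaleR_right scaleR_diff_right del: of_nat_Suc)
    finally show "norm (f n y - blinfun_apply (frechet_D F y) k)
        \<le> 32 * M / R\<^sup>2 * (norm k)\<^sup>2 * (1 / real (Suc n))" .
  next
    show "(\<lambda>n. 32 * M / R\<^sup>2 * (norm k)\<^sup>2 * (1 / real (Suc n))) \<longlonglongrightarrow> 0"
      using LIMSEQ_inverse_real_of_nat
      by (intro tendsto_mult_right_zero) (simp add: inverse_eq_divide)
  qed (use R in auto)
qed

lemma holomorphic_directional_derivative:
  fixes F :: "'a::complex_banach \<Rightarrow> 'b::complex_banach"
  assumes F: "holomorphic_map_on F S" and S: "open S"
  shows "holomorphic_map_on (\<lambda>y. blinfun_apply (frechet_D F y) k) S"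
  unfolding holomorphic_map_on_def
proof
  fix x assume x: "x \<in> S"
  obtain R M where R: "R > 0" "ball x R \<subseteq> S" and M: "\<And>y. y \<in> ball x R \<Longrightarrow> norm (F y) \<le> M"
    using holomorphic_map_locally_bounded[OF F S x] by metis
  \<comment> \<open>Shrinking by \<open>c\<close> brings the direction under the bound
    \<open>R / 4\<close> of the preceding lemma, and linearity removes the factor again; the summand
    1 covers \<open>k = 0\<close>.\<close>
  define c where "c = R / (8 * (norm k + 1))"
  have c: "c > 0" using R by (simp add: c_def add_nonneg_pos)
  have "norm (c *\<^sub>R k) = R / 8 * (norm k / (norm k + 1))"
    using R by (simp add: c_def)
  also have "\<dots> \<le> R / 8 * 1"
    using R by (intro mult_left_mono) (auto simp: divide_le_eq_1 add_nonneg_pos)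
  finally have "norm (c *\<^sub>R k) < R / 4" using R by simp
  then obtain L where L: "bounded_clinear L"
      "((\<lambda>y. blinfun_apply (frechet_D F y) (c *\<^sub>R k)) has_derivative L) (at x)"
    using directional_derivative_differentiable_aux[OF holomorphic_map_on_subset[OF F R(2)] M] by blast
  have "((\<lambda>y. (1 / c) *\<^sub>R blinfun_apply (frechet_D F y) (c *\<^sub>R k)) has_derivative (\<lambda>h. (1 / c) *\<^sub>R L h)) (at x)"
    by (intro has_derivative_scaleR_right L)
  then have "((\<lambda>y. blinfun_apply (frechet_D F y) k) has_derivative (\<lambda>h. (1 / c) *\<^sub>R L h)) (at x)"
    using c by (simp add: blinfun.scaleR_right)
  moreover have "bounded_clinear (\<lambda>h. (1 / c) *\<^sub>R L h)"
    by (intro bounded_clinear_scaleR L)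
  ultimately show "\<exists>L. bounded_clinear L \<and> ((\<lambda>y. blinfun_apply (frechet_D F y) k) has_derivative L) (at x)"
    by blast
qed

text \<open>For each direction \<open>k\<close> the map \<open>DF(.)k\<close> has a derivative
  \<open>B k\<close> at \<open>x\<close>, linear and bounded in \<open>k\<close>, so exchanging the
  two arguments gives the candidate \<open>Q\<close>. Taylor's estimate for \<open>G k\<close>
  carries the factor \<open>norm k\<close>, which turns the pointwise remainders into one in
  operator norm.\<close>

theorem holomorphic_frechet_D:
  fixes F :: "'a::complex_banach \<Rightarrow> 'b::complex_banach"
  assumes F: "holomorphic_map_on F S" and S: "open S"
  shows "holomorphic_map_on (frechet_D F) S"
  unfolding holomorphic_map_on_def
proof
  fix x assume x: "x \<in> S"
  obtain R M where R: "R > 0" "ball x R \<subseteq> S" and M: "\<And>y. y \<in> ball x R \<Longrightarrow> norm (F y) \<le> M"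
    using holomorphic_map_locally_bounded[OF F S x] by metis
  note FR = holomorphic_map_on_subset[OF F R(2)]
  define G where "G k y = blinfun_apply (frechet_D F y) k" for k y
  note hol = holomorphic_directional_derivative[OF F S, folded G_def]
  define B where "B k = frechet_D (G k) x" for k
  define K where "K = 4 * M / R"
  have dB: "(G k has_derivative blinfun_apply (B k)) (at x)" for k
    unfolding B_def by (rule bounded_clinear_frechet_D(2)[OF hol x])
  have Beq: "B k = L" if "(G k has_derivative blinfun_apply L) (at x)" for k L
    using frechet_D_eq[OF that] by (simp add: B_def blinfun_apply_inverse)
  have holR: "holomorphic_map_on (G k) (ball x (R / 2))" for k
    using R by (intro holomorphic_map_on_subset[OF hol]) auto
  have Gb: "norm (G k y) \<le> K * norm k" if "y \<in> ball x (R / 2)" for k y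
  proof -
    have "norm (G k y) \<le> norm (frechet_D F y) * norm k" unfolding G_def by (rule norm_blinfun)
    also have "\<dots> \<le> K * norm k"
      unfolding K_def by (intro mult_right_mono frechet_D_bound[OF FR M that]) auto
    finally show ?thesis .
  qed
  have Bb: "norm (B k) \<le> norm k * (4 * K / R)" for k
    using Cauchy_estimate[OF holR _ Gb, of k] R(1) by (simp add: B_def mult_ac)
  have Gadd: "G (k + k') = (\<lambda>y. G k y + G k' y)" for k k'
    by (simp add: G_def fun_eq_iff blinfun.add_right)
  have Gsc: "G (r *\<^sub>R k) = (\<lambda>y. r *\<^sub>R G k y)" for r k
    by (simp add: G_def fun_eq_iff blinfun.scaleR_right)
  \<comment> \<open>Linearity in \<open>k\<close> comes from uniqueness of derivatives.\<close>
  have Badd: "B (k + k') = B k + B k'" for k k'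
    using has_derivative_add[OF dB[of k] dB[of k']]
    by (intro Beq) (simp add: Gadd plus_blinfun.rep_eq)
  have Bsc: "B (r *\<^sub>R k) = r *\<^sub>R B k" for r k
    using has_derivative_scaleR_right[OF dB[of k], of r]
    by (intro Beq) (simp add: Gsc scaleR_blinfun.rep_eq)
  define Q where "Q h = Blinfun (\<lambda>k. blinfun_apply (B k) h)" for h
  have "bounded_linear B" by (rule bounded_linear_intro[OF Badd Bsc Bb])
  then have Q: "blinfun_apply (Q h) k = blinfun_apply (B k) h" for h k
    unfolding Q_def
    by (subst bounded_linear_Blinfun_apply)
       (auto intro: bounded_linear_compose[OF blinfun.bounded_linear_left])
  have K: "K \<ge> 0" unfolding K_def using order_trans[OF norm_ge_zero M[of x]] R by simp
  have "bounded_clinear Q"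
  proof (rule bounded_clinearI[where K = "4 * K / R"])
    show "Q (x + y) = Q x + Q y" for x y
      by (rule blinfun_eqI) (simp add: Q blinfun.add_left blinfun.add_right)
    show "Q (c *\<^sub>C h) = c *\<^sub>C Q h" for c h
      using bounded_clinear_frechet_D(1)[OF hol x]
      by (intro blinfun_eqI) (simp add: Q B_def bounded_clinear_def)
    show "norm (Q h) \<le> norm h * (4 * K / R)" for h
    proof (rule norm_blinfun_bound)
      fix k
      have "norm (blinfun_apply (B k) h) \<le> norm (B k) * norm h" by (rule norm_blinfun)
      also have "\<dots> \<le> norm k * (4 * K / R) * norm h" by (intro mult_right_mono Bb) auto
      finally show "norm (blinfun_apply (Q h) k) \<le> norm h * (4 * K / R) * norm k"
        by (simp add: Q mult_ac)
    qed (use K R in auto)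
  qed
  moreover have "(frechet_D F has_derivative Q) (at x)"
  proof (rule has_derivativeI_quadratic)
    show "bounded_linear Q" by (rule bounded_clinear_imp_bounded_linear) fact
    fix h :: 'a assume h: "norm h < R / 4"
    show "norm (frechet_D F (x + h) - frechet_D F x - Q h) \<le> 32 * K / R\<^sup>2 * (norm h)\<^sup>2"
    proof (rule norm_blinfun_bound)
      fix k
      have "norm (G k (x + h) - G k x - blinfun_apply (B k) h)
          \<le> 8 * (K * norm k) / (R / 2)\<^sup>2 * (norm h)\<^sup>2"
        unfolding B_def by (rule Taylor_estimate[OF holR _ Gb]) (use h R in auto)
      then show "norm (blinfun_apply (frechet_D F (x + h) - frechet_D F x - Q h) k)
          \<le> 32 * K / R\<^sup>2 * (norm h)\<^sup>2 * norm k"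
        by (simp add: Q G_def blinfun.diff_left power_divide mult_ac)
    qed (use K in auto)
  qed (use R in auto)
  ultimately show "\<exists>L. bounded_clinear L \<and> (frechet_D F has_derivative L) (at x)" by blast
qed

section \<open>The one-variable problem\<close>

lemma bounded_clinear_apply:
  assumes "bounded_clinear (T :: 'b::complex_banach \<Rightarrow> complex)"
  shows "bounded_clinear (\<lambda>L :: 'a::complex_banach \<Rightarrow>\<^sub>L 'b. T (blinfun_apply L x))"
  using assms bounded_linear_compose[of T "\<lambda>L. blinfun_apply L x"] blinfun.bounded_linear_left
  by (auto simp: bounded_clinear_def)

lemma scaleC_in_unit_ball:
  "norm x0 = 1 \<Longrightarrow> z *\<^sub>C (x0::'a::complex_banach) \<in> ball 0 1 \<longleftrightarrow> z \<in> ball 0 1"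
  by (simp add: norm_scaleC)

lemma has_field_derivative_on_disc:
  fixes G :: "'a::complex_banach \<Rightarrow> 'b::complex_banach"
  assumes G: "holomorphic_map_on G (ball 0 1)" and T: "bounded_clinear (T :: 'b \<Rightarrow> complex)"
    and x0: "norm x0 = 1" and z: "z \<in> ball 0 1"
  shows "((\<lambda>z. T (G (z *\<^sub>C x0))) has_field_derivative
    T (blinfun_apply (frechet_D G (z *\<^sub>C x0)) x0)) (at z)"
  using has_field_derivative_along_line[of G _ 0 z x0, OF _ _ T] bounded_clinear_frechet_D[OF G]
    scaleC_in_unit_ball[OF x0] z by simp

text \<open>One differentiation is peeled off from the inside, so the right side again has the form
  of the left, with \<open>frechet_D G\<close> and the functional that evaluates at
  \<open>x0\<close> before applying \<open>T\<close>.\<close>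

lemma higher_deriv_on_disc:
  fixes G :: "'a::complex_banach \<Rightarrow> 'b::complex_banach"
  assumes "holomorphic_map_on G (ball 0 1)" "bounded_clinear (T :: 'b \<Rightarrow> complex)" "norm x0 = 1"
  shows "(deriv ^^ Suc n) (\<lambda>z. T (G (z *\<^sub>C x0))) 0 =
    (deriv ^^ n) (\<lambda>z. T (blinfun_apply (frechet_D G (z *\<^sub>C x0)) x0)) 0"
proof -
  have "\<forall>\<^sub>F z in nhds 0. z \<in> ball (0::complex) 1" by (intro eventually_nhds_in_open) auto
  then have "\<forall>\<^sub>F z in nhds 0. deriv (\<lambda>z. T (G (z *\<^sub>C x0))) z =
      T (blinfun_apply (frechet_D G (z *\<^sub>C x0)) x0)"
    by eventually_elim (rule DERIV_imp_deriv[OF has_field_derivative_on_disc[OF assms]])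
  then show ?thesis
    unfolding funpow_Suc_right o_def by (intro higher_deriv_cong_ev) auto
qed

text \<open>\<open>higher_deriv_on_disc\<close> is applied to \<open>F\<close> and its first three
  derivatives; \<open>t1\<close> to \<open>t3\<close> absorb the evaluations at \<open>x0\<close>
  into the functional.\<close>

lemma A_eq_higher_deriv:
  fixes F :: "'a::complex_banach \<Rightarrow> 'a"
  assumes F: "holomorphic_map_on F (ball 0 1)" and T: "bounded_clinear T" and x0: "norm x0 = 1"
  defines "f \<equiv> \<lambda>z. T (F (z *\<^sub>C x0))"
  shows "A2 F x0 T = (deriv ^^ 2) f 0 / fact 2" "A3 F x0 T = (deriv ^^ 3) f 0 / fact 3"
    "A4 F x0 T = (deriv ^^ 4) f 0 / fact 4"
proof -
  have n: "(2::nat) = Suc (Suc 0)" "(3::nat) = Suc (Suc (Suc 0))" "(4::nat) = Suc (Suc (Suc (Suc 0)))"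
    by simp_all
  note h1 = holomorphic_frechet_D[OF F open_ball]
  note h2 = holomorphic_frechet_D[OF h1 open_ball]
  note h3 = holomorphic_frechet_D[OF h2 open_ball]
  note t1 = bounded_clinear_apply[OF T, of x0]
  note t2 = bounded_clinear_apply[OF t1, of x0]
  note t3 = bounded_clinear_apply[OF t2, of x0]
  note hd = higher_deriv_on_disc[OF F T x0] higher_deriv_on_disc[OF h1 t1 x0]
    higher_deriv_on_disc[OF h2 t2 x0] higher_deriv_on_disc[OF h3 t3 x0]
  show "A2 F x0 T = (deriv ^^ 2) f 0 / fact 2" "A3 F x0 T = (deriv ^^ 3) f 0 / fact 3"
    "A4 F x0 T = (deriv ^^ 4) f 0 / fact 4"
    unfolding f_def A2_def A3_def A4_def n hd by simp_all
qed

section \<open>Schwarz functions and Schur's algorithm\<close>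

lemma norm_le_1_of_Schwarz:
  assumes "\<phi> holomorphic_on ball 0 1" "\<And>z. z \<in> ball 0 1 \<Longrightarrow> cmod (z * \<phi> z) < 1" "z \<in> ball 0 1"
  shows "cmod (\<phi> z) \<le> 1"
proof -
  have hol: "(\<lambda>z. z * \<phi> z) holomorphic_on ball 0 1" by (intro holomorphic_intros assms)
  note S = Schwarz_Lemma[OF hol, simplified]
  show ?thesis
  proof (cases "z = 0")
    case True
    \<comment> \<open>Division by \<open>z\<close> fails at the origin; there
      \<open>\<phi> 0\<close> is the derivative of \<open>z * \<phi> z\<close>, which the Schwarz
      lemma also bounds.\<close>
    have "(\<phi> has_field_derivative deriv \<phi> 0) (at 0)"
      by (rule holomorphic_derivI[OF assms(1)]) auto
    then have "((\<lambda>z. z * \<phi> z) has_field_derivative \<phi> 0) (at 0)"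
      by (auto intro!: derivative_eq_intros)
    then have "deriv (\<lambda>z. z * \<phi> z) 0 = \<phi> 0" by (rule DERIV_imp_deriv)
    then show ?thesis using S(2)[of 0] assms(2) True by simp
  next
    case False
    then have "cmod (z * \<phi> z) \<le> cmod z * 1" using S(1)[of z] assms(2,3) by simp
    then show ?thesis using False unfolding norm_mult by simp
  qed
qed

text \<open>A disc automorphism sends \<open>\<phi> 0\<close> to 0 and the Schwarz lemma divides by
  \<open>z\<close>. The relation is stated without a quotient so that it also covers unimodular
  constants, with \<open>\<psi> = 0\<close>.\<close>

lemma Schur_step:
  assumes hol: "\<phi> holomorphic_on ball 0 1" and le: "\<And>z. z \<in> ball 0 1 \<Longrightarrow> cmod (\<phi> z) \<le> 1"
  shows "\<exists>\<psi>. \<psi> holomorphic_on ball 0 1 \<and> (\<forall>z\<in>ball 0 1. cmod (\<psi> z) \<le> 1) \<and>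
    (\<forall>z\<in>ball 0 1. \<phi> z - \<phi> 0 = z * \<psi> z * (1 - cnj (\<phi> 0) * \<phi> z))"
proof (cases "\<exists>w\<in>ball 0 1. cmod (\<phi> w) = 1")
  case True
  then obtain w where w: "w \<in> ball 0 1" "cmod (\<phi> w) = 1" by blast
  have "\<phi> constant_on ball 0 1"
    by (rule maximum_modulus_principle[OF hol, where U = "ball 0 1" and \<xi> = w]) (use le w in auto)
  then obtain c where "\<forall>z\<in>ball 0 1. \<phi> z = c" unfolding constant_on_def by blast
  then show ?thesis by (intro exI[of _ "\<lambda>_. 0"]) auto
next
  case False
  then have lt: "cmod (\<phi> z) < 1" if "z \<in> ball 0 1" for z
    using le[OF that] False that by (auto simp: order_le_less)
  then have lt0: "cmod (\<phi> 0) < 1" by simp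
  have nz: "1 - cnj (\<phi> 0) * \<phi> z \<noteq> 0" if "z \<in> ball 0 1" for z
  proof
    assume "1 - cnj (\<phi> 0) * \<phi> z = 0"
    then have "cmod (cnj (\<phi> 0) * \<phi> z) = 1" by simp
    then have "cmod (\<phi> 0) * cmod (\<phi> z) = 1" by (simp add: norm_mult)
    moreover have "cmod (\<phi> 0) * cmod (\<phi> z) \<le> cmod (\<phi> 0) * 1"
      using le[OF that] by (intro mult_left_mono) auto
    ultimately show False using lt0 by simp
  qed
  define h where "h z = (\<phi> z - \<phi> 0) / (1 - cnj (\<phi> 0) * \<phi> z)" for z
  have holh: "h holomorphic_on ball 0 1"
    unfolding h_def by (intro holomorphic_intros hol nz)
  have hlt: "cmod (h z) < 1" if "z \<in> ball 0 1" for z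
    using Moebius_function_norm_lt_1[OF lt0 lt[OF that], of 0]
    by (simp add: Moebius_function_simple h_def)
  obtain \<psi> where \<psi>: "\<psi> holomorphic_on ball 0 1" "\<And>z. cmod z < 1 \<Longrightarrow> h z = z * \<psi> z"
    using Schwarz3[OF holh] by (auto simp: h_def)
  have "cmod (w * \<psi> w) < 1" if "w \<in> ball 0 1" for w
    using hlt[OF that] \<psi>(2)[of w] that by simp
  then have "cmod (\<psi> z) \<le> 1" if "z \<in> ball 0 1" for z
    using norm_le_1_of_Schwarz[OF \<psi>(1) _ that] by blast
  moreover have "\<phi> z - \<phi> 0 = z * \<psi> z * (1 - cnj (\<phi> 0) * \<phi> z)" if "z \<in> ball 0 1" for z
    using \<psi>(2)[of z] that nz[OF that] by (simp add: h_def divide_eq_eq)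
  ultimately show ?thesis using \<psi>(1) by blast
qed

lemma has_fps_expansion_unit_disc:
  "f holomorphic_on ball 0 1 \<Longrightarrow> f has_fps_expansion fps_expansion f 0"
  by (rule has_fps_expansion_fps_expansion[of "ball 0 1"]) auto

text \<open>Turns functional equations into identities of power series, from which coefficients are
  read off.\<close>

lemma fps_eq_on_unit_disc:
  assumes "f has_fps_expansion F" "g has_fps_expansion G"
    and "\<And>z::complex. z \<in> ball 0 1 \<Longrightarrow> f z = g z"
  shows "F = G"
proof -
  have "\<forall>\<^sub>F z in nhds 0. z \<in> ball (0::complex) 1" by (intro eventually_nhds_in_open) auto
  then have "\<forall>\<^sub>F z in nhds 0. f z = g z" by eventually_elim (rule assms)
  then have "g has_fps_expansion F" using has_fps_expansion_cong[of f g F F] assms(1) by simp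
  then show ?thesis using assms(2) by (rule fps_expansion_unique_complex)
qed

lemma fps_expansion_nth_0: "fps_nth (fps_expansion f 0) 0 = f 0"
  by (simp add: fps_expansion_def)

lemma Schur_step_fps:
  assumes "\<phi> holomorphic_on ball 0 1" "\<And>z. z \<in> ball 0 1 \<Longrightarrow> cmod (\<phi> z) \<le> 1"
  shows "\<exists>\<psi>. \<psi> holomorphic_on ball 0 1 \<and> (\<forall>z\<in>ball 0 1. cmod (\<psi> z) \<le> 1) \<and>
    fps_expansion \<phi> 0 - fps_const (\<phi> 0) =
      fps_X * fps_expansion \<psi> 0 * (1 - fps_const (cnj (\<phi> 0)) * fps_expansion \<phi> 0)"
proof -
  obtain \<psi> where \<psi>: "\<psi> holomorphic_on ball 0 1" "\<forall>z\<in>ball 0 1. cmod (\<psi> z) \<le> 1"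
    "\<forall>z\<in>ball 0 1. \<phi> z - \<phi> 0 = z * \<psi> z * (1 - cnj (\<phi> 0) * \<phi> z)"
    using Schur_step[OF assms] by blast
  have "fps_expansion \<phi> 0 - fps_const (\<phi> 0) =
      fps_X * fps_expansion \<psi> 0 * (1 - fps_const (cnj (\<phi> 0)) * fps_expansion \<phi> 0)"
    by (rule fps_eq_on_unit_disc[of "\<lambda>z. \<phi> z - \<phi> 0" _ "\<lambda>z. z * \<psi> z * (1 - cnj (\<phi> 0) * \<phi> z)"])
       (use \<psi>(3) in \<open>auto intro!: fps_expansion_intros has_fps_expansion_unit_disc assms(1) \<psi>(1)\<close>)
  then show ?thesis using \<psi> by blast
qed

text \<open>Here \<open>x\<close> is the value and \<open>y\<close> the first Taylor coefficient at
  0 of the Schur transform \<open>\<psi>\<close>. A second step factors \<open>y\<close> as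
  \<open>1 - (cmod x)^2\<close> times a number of modulus at most 1; comparing coefficients in the
  first step yields \<open>w 1\<close> and \<open>w 2\<close>.\<close>

lemma Schur_coefficients:
  assumes "\<phi> holomorphic_on ball 0 1" "\<And>z. z \<in> ball 0 1 \<Longrightarrow> cmod (\<phi> z) \<le> 1"
  defines "w \<equiv> fps_nth (fps_expansion \<phi> 0)"
  shows "\<exists>x y. cmod x \<le> 1 \<and> cmod y \<le> 1 - (cmod x)\<^sup>2 \<and>
    w 1 = of_real (1 - (cmod (w 0))\<^sup>2) * x \<and>
    w 2 = of_real (1 - (cmod (w 0))\<^sup>2) * (y - cnj (w 0) * x\<^sup>2)"
proof -
  obtain \<psi> where \<psi>: "\<psi> holomorphic_on ball 0 1" "\<And>z. z \<in> ball 0 1 \<Longrightarrow> cmod (\<psi> z) \<le> 1"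
    "fps_expansion \<phi> 0 - fps_const (\<phi> 0) =
      fps_X * fps_expansion \<psi> 0 * (1 - fps_const (cnj (\<phi> 0)) * fps_expansion \<phi> 0)"
    using Schur_step_fps[OF assms(1,2)] by blast
  obtain \<omega> where \<omega>: "\<omega> holomorphic_on ball 0 1" "\<And>z. z \<in> ball 0 1 \<Longrightarrow> cmod (\<omega> z) \<le> 1"
    "fps_expansion \<psi> 0 - fps_const (\<psi> 0) =
      fps_X * fps_expansion \<omega> 0 * (1 - fps_const (cnj (\<psi> 0)) * fps_expansion \<psi> 0)"
    using Schur_step_fps[OF \<psi>(1,2)] by blast
  define x y where "x = \<psi> 0" and "y = fps_nth (fps_expansion \<psi> 0) 1"
  have sq: "of_real (1 - (cmod a)\<^sup>2) = 1 - cnj a * a" for a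
    unfolding of_real_diff of_real_1 complex_norm_square by (simp add: mult.commute)
  have w0: "w 0 = \<phi> 0" by (simp add: w_def fps_expansion_nth_0)
  have coeff: "fps_nth (fps_X * A * (1 - fps_const c * B)) 1 = fps_nth A 0 * (1 - c * fps_nth B 0)"
    "fps_nth (fps_X * A * (1 - fps_const c * B)) 2 =
      fps_nth A 1 * (1 - c * fps_nth B 0) - fps_nth A 0 * c * fps_nth B 1"
    for A B :: "complex fps" and c
    by (simp_all add: mult.assoc fps_mult_nth numeral_2_eq_2 algebra_simps)
  have y: "y = (1 - cnj x * x) * \<omega> 0"
    using arg_cong[OF \<omega>(3), of "\<lambda>F. fps_nth F 1"]
    by (simp add: coeff y_def x_def fps_expansion_nth_0)
  have x1: "cmod x \<le> 1" using \<psi>(2) by (simp add: x_def)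
  have "cmod y = (1 - (cmod x)\<^sup>2) * cmod (\<omega> 0)"
  proof -
    have "cmod (1 - cnj x * x) = 1 - (cmod x)\<^sup>2"
      unfolding sq[symmetric] norm_of_real using x1 by (simp add: power_le_one)
    then show ?thesis by (simp only: y norm_mult)
  qed
  also have "\<dots> \<le> (1 - (cmod x)\<^sup>2) * 1"
    using \<omega>(2) x1 by (intro mult_left_mono) (auto simp: power_le_one)
  finally have "cmod y \<le> 1 - (cmod x)\<^sup>2" by simp
  moreover have w1: "w 1 = (1 - cnj (w 0) * w 0) * x"
    using arg_cong[OF \<psi>(3), of "\<lambda>F. fps_nth F 1"]
    by (simp add: coeff w_def x_def fps_expansion_nth_0)
  moreover have "w 2 = (1 - cnj (w 0) * w 0) * (y - cnj (w 0) * x\<^sup>2)"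
  proof -
    have "w 2 = y * (1 - cnj (w 0) * w 0) - x * cnj (w 0) * w 1"
      using arg_cong[OF \<psi>(3), of "\<lambda>F. fps_nth F 2"]
      by (simp add: coeff w_def x_def y_def fps_expansion_nth_0)
    then show ?thesis unfolding w1 by (simp add: algebra_simps power2_eq_square)
  qed
  ultimately show ?thesis
    unfolding sq using x1 by (intro exI[of _ x] exI[of _ y] conjI)
qed

text \<open>The two \<open>x\<^sup>2\<close> terms are merged before the triangle inequality is
  used. With \<open>t = cmod a\<close> and \<open>r = cmod x\<close> the bound on the bracket is
  increasing in \<open>r\<close>, so \<open>r = 1\<close> is the worst case, and
  \<open>(1 - t^2) (3 + 3 t^2) + 3 t^4 = 3\<close> closes the estimate exactly.\<close>

lemma Hankel_polynomial_bound:
  fixes a x y s :: complex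
  assumes a: "cmod a \<le> 1" and x: "cmod x \<le> 1" and y: "cmod y \<le> 1 - (cmod x)\<^sup>2" and s: "cmod s \<le> 3"
  defines "d \<equiv> 1 - (cmod a)\<^sup>2"
  shows "cmod (4 * a * (of_real d * (y - cnj a * x\<^sup>2)) + 2 * a\<^sup>2 * (of_real d * x)
    - 3 * (of_real d * x)\<^sup>2 + s * a ^ 4) \<le> 3"
proof -
  define t r where "t = cmod a" and "r = cmod x"
  have d0: "d \<ge> 0" using a by (simp add: d_def power_le_one)
  have t: "0 \<le> t" "t \<le> 1" and r: "0 \<le> r" "r \<le> 1" using a x by (simp_all add: t_def r_def)
  have aa: "a * cnj a = of_real (t\<^sup>2)" by (simp only: t_def complex_norm_square)
  have e: "4 * a * (of_real d * (y - cnj a * x\<^sup>2)) =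
      of_real d * (4 * a * y - 4 * (a * cnj a) * x\<^sup>2)"
    by (simp add: algebra_simps)
  have "4 * a * (of_real d * (y - cnj a * x\<^sup>2)) + 2 * a\<^sup>2 * (of_real d * x)
      - 3 * (of_real d * x)\<^sup>2 + s * a ^ 4
    = of_real d * (4 * a * y + 2 * a\<^sup>2 * x - of_real (4 * t\<^sup>2 + 3 * d) * x\<^sup>2) + s * a ^ 4"
    (is "_ = of_real d * ?C + _")
    unfolding e aa by (simp add: algebra_simps power2_eq_square)
  also have "cmod \<dots> \<le> d * cmod ?C + cmod (s * a ^ 4)"
    using norm_triangle_ineq[of "of_real d * ?C" "s * a ^ 4"] d0 by (simp add: norm_mult)
  also have "\<dots> \<le> d * (3 + 3 * t\<^sup>2) + 3 * t ^ 4"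
  proof (intro add_mono mult_left_mono d0)
    have "cmod ?C \<le> cmod (4 * a * y) + cmod (2 * a\<^sup>2 * x) + cmod (of_real (4 * t\<^sup>2 + 3 * d) * x\<^sup>2)"
      by (intro order_trans[OF norm_triangle_ineq4] add_right_mono norm_triangle_ineq)
    also have "\<dots> = 4 * t * cmod y + 2 * t\<^sup>2 * r + (4 * t\<^sup>2 + 3 * d) * r\<^sup>2"
      unfolding norm_mult norm_power norm_of_real using d0 by (simp add: t_def r_def)
    also have "\<dots> \<le> 4 * t * (1 - r\<^sup>2) + 2 * t\<^sup>2 * r + (4 * t\<^sup>2 + 3 * d) * r\<^sup>2"
      using y t by (intro add_right_mono mult_left_mono) (auto simp: r_def)
    \<comment> \<open>The coefficient of \<open>r\<^sup>2\<close> is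
      \<open>4 t^2 + 3 d - 4 t\<close>, which factors and is nonnegative for
      \<open>t \<le> 1\<close>.\<close>
    also have "\<dots> = 4 * t + 2 * t\<^sup>2 * r + (1 - t) * (3 - t) * r\<^sup>2"
      unfolding d_def t_def[symmetric] by (simp add: algebra_simps power2_eq_square)
    also have "\<dots> \<le> 4 * t + 2 * t\<^sup>2 * 1 + (1 - t) * (3 - t) * 1"
      using t r by (intro add_mono mult_left_mono mult_nonneg_nonneg) (auto simp: power_le_one)
    also have "\<dots> = 3 + 3 * t\<^sup>2" by (simp add: algebra_simps power2_eq_square)
    finally show "cmod ?C \<le> 3 + 3 * t\<^sup>2" .
    show "cmod (s * a ^ 4) \<le> 3 * t ^ 4"
      unfolding norm_mult norm_power t_def using s by (intro mult_right_mono) auto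
  qed
  also have "\<dots> = 3"
    unfolding d_def t_def[symmetric] by (simp add: algebra_simps power2_eq_square power4_eq_xxxx)
  finally show ?thesis .
qed

section \<open>Spirallike functions on the disc\<close>

lemma Re_of_real_mult: "Re (complex_of_real r * z) = r * Re z"
  by simp

lemma higher_deriv_mult_ident:
  assumes "u holomorphic_on ball 0 1"
  shows "(deriv ^^ Suc n) (\<lambda>z. z * u z) 0 / fact (Suc n) = fps_nth (fps_expansion u 0) n"
proof -
  have "(\<lambda>z. z * u z) has_fps_expansion fps_X * fps_expansion u 0"
    by (intro fps_expansion_intros has_fps_expansion_unit_disc assms)
  from fps_nth_fps_expansion[OF this, of "Suc n"] show ?thesis by simp
qed

lemma deriv_mult_ident:
  assumes "u holomorphic_on ball 0 1" "z \<in> ball 0 1"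
  shows "deriv (\<lambda>z. z * u z) z = u z + z * deriv u z"
proof -
  have "(u has_field_derivative deriv u z) (at z)"
    by (rule holomorphic_derivI[OF assms(1) _ assms(2)]) simp
  then have "((\<lambda>z. z * u z) has_field_derivative (u z + z * deriv u z)) (at z)"
    by (auto intro!: derivative_eq_intros)
  then show ?thesis by (rule DERIV_imp_deriv)
qed

text \<open>The squared modulus collapses to \<open>1 + 8 (cos \<beta>)^2\<close>, which is at most
  9.\<close>

lemma cmod_one_minus_4_cos_cis:
  "cmod (1 - 4 * (cis (- \<beta>) * of_real (cos \<beta>))\<^sup>2) \<le> 3"
proof -
  let ?w = "1 - 4 * (cis (- \<beta>) * of_real (cos \<beta>))\<^sup>2" and ?c = "cos \<beta>"
  have s2: "(sin \<beta>)\<^sup>2 = 1 - ?c\<^sup>2" using sin_cos_squared_add[of \<beta>] by linarith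
  have "Re ?w = 1 - 4 * ?c\<^sup>2 * (?c\<^sup>2 - (sin \<beta>)\<^sup>2)" "Im ?w = 8 * ?c\<^sup>2 * ?c * sin \<beta>"
    by (simp_all add: power2_eq_square algebra_simps)
  then have "(cmod ?w)\<^sup>2 = (1 - 4 * ?c\<^sup>2 * (?c\<^sup>2 - (sin \<beta>)\<^sup>2))\<^sup>2 + 64 * (?c\<^sup>2)\<^sup>2 * (?c\<^sup>2 * (sin \<beta>)\<^sup>2)"
    by (simp only: cmod_power2) (simp add: power2_eq_square)
  also have "\<dots> = 1 + 8 * ?c\<^sup>2"
    unfolding s2 by (simp add: power2_eq_square algebra_simps)
  also have "\<dots> \<le> 3\<^sup>2" using cos_le_one[of \<beta>] abs_cos_le_one[of \<beta>] by (simp add: abs_square_le_1)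
  finally show ?thesis by (rule power2_le_imp_le) simp
qed

text \<open>Writing \<open>\<tau> = exp(-i\<beta>) cos \<beta>\<close>, the half-plane condition means that
  \<open>z f'(z) / f(z) = 1 + 2 \<tau> \<omega>(z) / (1 - \<omega>(z))\<close> for a Schwarz function \<open>\<omega>\<close>; below \<open>\<omega>(z) = z \<phi>(z)\<close>.\<close>

lemma Hankel_bound_disc:
  assumes u: "u holomorphic_on ball 0 1" and u0: "u 0 = 1" and c: "cos \<beta> > 0"
  defines "f \<equiv> \<lambda>z. z * u z"
  assumes nz: "\<And>z. z \<in> ball 0 1 \<Longrightarrow> deriv f z \<noteq> 0"
    and pos: "\<And>z. z \<in> ball 0 1 \<Longrightarrow> Re (cis (- \<beta>) * (u z / deriv f z)) > 0"
  defines "a \<equiv> \<lambda>n. (deriv ^^ n) f 0 / fact n"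
  shows "cmod (a 2 * a 4 - (a 3)\<^sup>2) \<le> (cos \<beta>)\<^sup>2"
proof -
  define \<tau> where "\<tau> = cis (- \<beta>) * of_real (cos \<beta>)"
  \<comment> \<open>Since \<open>z f'(z) / f(z) = 1 + z u'(z) / u(z)\<close>, solving for the
    Schwarz function gives \<open>\<omega>(z) = z u'(z) / D(z)\<close>, with no division by
    \<open>u\<close>.\<close>
  define D where "D z = z * deriv u z + 2 * \<tau> * u z" for z
  define \<phi> where "\<phi> z = deriv u z / D z" for z
  have df: "deriv f z = u z + z * deriv u z" if "z \<in> ball 0 1" for z
    unfolding f_def by (rule deriv_mult_ident[OF u that])
  have cc: "cis (- \<beta>) * cis \<beta> = 1" by (simp add: cis_mult)
  have "2 * of_real (cos \<beta>) = cis \<beta> + cis (- \<beta>)" by (simp add: complex_eq_iff)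
  then have "2 * \<tau> = cis (- \<beta>) * (cis \<beta> + cis (- \<beta>))" by (simp add: \<tau>_def)
  then have tau2: "2 * \<tau> = 1 + cis (- \<beta>) * cis (- \<beta>)" by (simp only: distrib_left cc)
  have lt: "cmod (z * deriv u z) < cmod (D z)" if z: "z \<in> ball 0 1" for z
  proof -
    define q where "q = cis (- \<beta>) * (u z / deriv f z)"
    have q: "Re q > 0" using pos[OF z] by (simp add: q_def)
    have uz: "u z = cis \<beta> * q * deriv f z"
      using nz[OF z] by (simp add: q_def mult.assoc[symmetric] cis_mult)
    \<comment> \<open>A point \<open>q\<close> of the right half-plane is closer to
      \<open>cis (- \<beta>)\<close> than to its mirror image \<open>- cis \<beta>\<close> in the
      imaginary axis. Multiplied by \<open>cmod (deriv f z)\<close>, these distances are the moduli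
      of \<open>z u'\<close> and \<open>D\<close>.\<close>
    have "(cmod (cis (- \<beta>) - q))\<^sup>2 < (cmod (cis \<beta> + q))\<^sup>2"
      unfolding cmod_power2 using mult_pos_pos[OF c q] by (simp add: power2_eq_square algebra_simps)
    then have lt: "cmod (cis (- \<beta>) - q) < cmod (cis \<beta> + q)" by (rule power2_less_imp_less) simp
    have "z * deriv u z = deriv f z - u z" using df[OF z] by simp
    also have "\<dots> = deriv f z * cis \<beta> * (cis (- \<beta>) - q)"
      using cc by (simp add: uz algebra_simps)
    finally have 1: "cmod (z * deriv u z) = cmod (deriv f z) * cmod (cis (- \<beta>) - q)"
      by (simp add: norm_mult)
    have "D z = deriv f z + cis (- \<beta>) * cis (- \<beta>) * u z"
      unfolding D_def tau2 using df[OF z] by (simp add: algebra_simps)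
    also have "\<dots> = deriv f z * cis (- \<beta>) * (cis \<beta> + q)"
      using cc uz by algebra
    finally have "cmod (D z) = cmod (deriv f z) * cmod (cis \<beta> + q)" by (simp add: norm_mult)
    then show ?thesis using 1 lt nz[OF z] by simp
  qed
  then have Dnz: "D z \<noteq> 0" if "z \<in> ball 0 1" for z using that norm_ge_zero by fastforce
  have hol: "\<phi> holomorphic_on ball 0 1"
    unfolding \<phi>_def D_def by (intro holomorphic_intros u holomorphic_deriv) (use Dnz in \<open>auto simp: D_def\<close>)
  have "cmod (z * \<phi> z) < 1" if "z \<in> ball 0 1" for z
    using lt[OF that] Dnz[OF that] by (simp add: \<phi>_def norm_divide norm_mult divide_simps)
  then have le: "cmod (\<phi> z) \<le> 1" if "z \<in> ball 0 1" for z
    using norm_le_1_of_Schwarz[OF hol _ that] by blast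
  define U w where "U = fps_expansion u 0" and "w = fps_nth (fps_expansion \<phi> 0)"
  have dU: "deriv u has_fps_expansion fps_deriv U"
    unfolding U_def by (intro fps_expansion_intros has_fps_expansion_unit_disc u)
  \<comment> \<open>The relation \<open>\<phi> D = u'\<close>, read as power series, is a recursion
    for the coefficients of \<open>u\<close>.\<close>
  have "(\<lambda>z. \<phi> z * (z * deriv u z + 2 * \<tau> * u z)) has_fps_expansion
      fps_expansion \<phi> 0 * (fps_X * fps_deriv U + fps_const (2 * \<tau>) * U)"
    unfolding U_def
    by (intro has_fps_expansion_mult has_fps_expansion_add has_fps_expansion_fps_X
        has_fps_expansion_cmult_left has_fps_expansion_unit_disc u hol dU[unfolded U_def])
  from fps_eq_on_unit_disc[OF dU this]
  have "fps_deriv U = fps_expansion \<phi> 0 * (fps_X * fps_deriv U + fps_const (2 * \<tau>) * U)"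
    using Dnz by (simp add: \<phi>_def D_def)
  note eq = arg_cong[OF this, of "\<lambda>F. fps_nth F n" for n]
  \<comment> \<open>The index shifts by one because \<open>f\<close> is \<open>z\<close> times
    \<open>u\<close>.\<close>
  have U: "a (Suc n) = fps_nth U n" for n
    unfolding a_def f_def U_def by (rule higher_deriv_mult_ident[OF u])
  have U0: "fps_nth U 0 = 1" by (simp add: U_def fps_expansion_nth_0 u0)
  have a2: "a 2 = 2 * \<tau> * w 0"
    using eq[of 0] U[of 1] U0 by (simp add: w_def numeral_2_eq_2)
  have "2 * a 3 = w 0 * (1 + 2 * \<tau>) * a 2 + 2 * \<tau> * w 1"
    using eq[of 1] U[of 1] U[of 2] U0
    by (simp add: w_def fps_mult_nth numeral_eq_Suc algebra_simps)
  then have "2 * a 3 = 2 * (\<tau> * ((1 + 2 * \<tau>) * (w 0)\<^sup>2 + w 1))"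
    unfolding a2 by (simp add: power2_eq_square algebra_simps)
  then have a3: "a 3 = \<tau> * ((1 + 2 * \<tau>) * (w 0)\<^sup>2 + w 1)" by simp
  have "3 * a 4 = w 0 * (2 + 2 * \<tau>) * a 3 + w 1 * (1 + 2 * \<tau>) * a 2 + 2 * \<tau> * w 2"
    using eq[of 2] U[of 1] U[of 2] U[of 3] U0
    by (simp add: w_def fps_mult_nth numeral_eq_Suc algebra_simps)
  then have a4: "a 4 = (w 0 * (2 + 2 * \<tau>) * a 3 + w 1 * (1 + 2 * \<tau>) * a 2 + 2 * \<tau> * w 2) / 3"
    by (simp add: field_simps)
  have H: "a 2 * a 4 - (a 3)\<^sup>2 =
      \<tau>\<^sup>2 / 3 * (4 * w 0 * w 2 + 2 * (w 0)\<^sup>2 * w 1 - 3 * (w 1)\<^sup>2 + (1 - 4 * \<tau>\<^sup>2) * (w 0) ^ 4)"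
    unfolding a4 a3 a2 by (simp add: field_simps power2_eq_square power4_eq_xxxx)
  obtain x y where xy: "cmod x \<le> 1" "cmod y \<le> 1 - (cmod x)\<^sup>2"
      "w 1 = of_real (1 - (cmod (w 0))\<^sup>2) * x"
      "w 2 = of_real (1 - (cmod (w 0))\<^sup>2) * (y - cnj (w 0) * x\<^sup>2)"
    using Schur_coefficients[OF hol le, folded w_def] by blast
  have "cmod (w 0) \<le> 1" using le[of 0] by (simp add: w_def fps_expansion_nth_0)
  then have "cmod (4 * w 0 * w 2 + 2 * (w 0)\<^sup>2 * w 1 - 3 * (w 1)\<^sup>2 + (1 - 4 * \<tau>\<^sup>2) * (w 0) ^ 4) \<le> 3"
    unfolding xy(3,4) using xy(1,2) cmod_one_minus_4_cos_cis[of \<beta>, folded \<tau>_def]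
    by (intro Hankel_polynomial_bound)
  then have "cmod (a 2 * a 4 - (a 3)\<^sup>2) \<le> (cmod \<tau>)\<^sup>2 / 3 * 3"
    unfolding H norm_mult norm_divide norm_power by (intro mult_mono) auto
  also have "\<dots> = (cos \<beta>)\<^sup>2" by (simp add: \<tau>_def norm_mult)
  finally show ?thesis .
qed

section \<open>Reduction from the ball to the disc\<close>

lemma support_functionals_scaleC:
  assumes T: "T \<in> support_functionals x0" and x0: "norm x0 = 1" and z: "z \<noteq> 0"
  shows "(\<lambda>y. of_real (cmod z) / z * T y) \<in> support_functionals (z *\<^sub>C x0)"
proof -
  \<comment> \<open>This unimodular factor undoes the rotation by \<open>z\<close>, so the value at
    \<open>z *\<^sub>C x0\<close> becomes its norm.\<close>
  let ?c = "of_real (cmod z) / z"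
  have nc: "cmod ?c = 1" using z by (simp add: norm_divide)
  have T': "bounded_clinear T" "T x0 = 1" "onorm T = 1"
    using T x0 by (auto simp: support_functionals_def)
  have "onorm (\<lambda>y. ?c * T y) = 1"
  proof -
    have "norm (?c * T y) = norm (T y)" for y using nc by (simp only: norm_mult mult_1)
    then show ?thesis using T'(3) by (simp only: onorm_def)
  qed
  moreover have "bounded_clinear (\<lambda>y. ?c * T y)"
    using T'(1) bounded_linear_compose[OF bounded_linear_mult_right, of T ?c]
    unfolding bounded_clinear_def by simp
  moreover have "?c * T (z *\<^sub>C x0) = of_real (norm (z *\<^sub>C x0))"
    using z x0 by (simp add: norm_scaleC bounded_clinear_scaleC[OF T'(1)] T'(2))
  ultimately show ?thesis by (simp only: support_functionals_def mem_Collect_eq simp_thms)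
qed

text \<open>\<open>inv\<close> is defined by choice; the left inverse supplies the injectivity that
  pins down its value.\<close>

lemma inv_eq_of_left_inverse:
  assumes "L o\<^sub>L A = id_blinfun" "blinfun_apply A v = w"
  shows "inv (blinfun_apply A) w = v"
proof (rule inv_f_eq)
  have "blinfun_apply L (blinfun_apply A x) = x" for x
    using arg_cong[OF assms(1), of "\<lambda>B. blinfun_apply B x"] by simp
  then show "inj (blinfun_apply A)" by (metis injI)
qed (rule assms)

text \<open>\<open>DF(z x0)\<close> multiplies \<open>x0\<close> by \<open>f'(z)\<close>, so its
  inverse sends \<open>F(z x0)\<close> to \<open>(f / f') x0\<close>. Testing with the rotated
  functional turns the condition on \<open>F\<close> into the half-plane condition on
  \<open>f\<close>.\<close>

lemma Hankel_bound:
  fixes F :: "'a::complex_banach \<Rightarrow> 'a"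
  assumes c: "cos \<beta> > 0" and g: "holomorphic_map_on g (ball 0 1)" and g0: "g 0 = 1"
    and Fg: "\<And>x. x \<in> ball 0 1 \<Longrightarrow> F x = g x *\<^sub>C x" and F: "F \<in> spirallike \<beta>"
    and x0: "norm x0 = 1" and T: "T \<in> support_functionals x0"
  shows "cmod (H22 F x0 T) \<le> (cos \<beta>)\<^sup>2"
proof -
  define u where "u z = g (z *\<^sub>C x0)" for z
  define f where "f z = z * u z" for z
  have hF: "holomorphic_map_on F (ball 0 1)"
    and inv: "\<And>x. x \<in> ball 0 1 \<Longrightarrow> \<exists>L. L o\<^sub>L frechet_D F x = id_blinfun"
    and pos: "\<And>x T. x \<in> ball 0 1 - {0} \<Longrightarrow> T \<in> support_functionals x \<Longrightarrow>
      Re (cis (- \<beta>) * T (inv (blinfun_apply (frechet_D F x)) (F x))) > 0"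
    using F by (auto simp: spirallike_def locally_biholomorphic_def cis_conv_exp)
  have T': "bounded_clinear T" "T x0 = 1" using T x0 by (auto simp: support_functionals_def)
  have x00: "x0 \<noteq> 0" using x0 by auto
  have Fz: "F (z *\<^sub>C x0) = f z *\<^sub>C x0" if "z \<in> ball 0 1" for z
    using that Fg scaleC_in_unit_ball[OF x0, of z] by (simp add: f_def u_def scaleC_scaleC mult.commute)
  have hu: "u holomorphic_on ball 0 1"
    unfolding holomorphic_on_def
  proof
    fix z :: complex assume z: "z \<in> ball 0 1"
    have "bounded_clinear (\<lambda>c::complex. c)" by (simp add: bounded_clinear_def bounded_linear_ident)
    from has_field_derivative_on_disc[OF g this x0 z] show "u field_differentiable at z within ball 0 1"
      unfolding u_def field_differentiable_def by (blast intro: has_field_derivative_at_within)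
  qed
  then have hf: "f holomorphic_on ball 0 1" unfolding f_def by (intro holomorphic_intros)
  have DF: "blinfun_apply (frechet_D F (z *\<^sub>C x0)) x0 = deriv f z *\<^sub>C x0" if z: "z \<in> ball 0 1" for z
  proof -
    have zx: "z *\<^sub>C x0 \<in> ball 0 1" using scaleC_in_unit_ball[OF x0] z by blast
    have "((\<lambda>z. F (z *\<^sub>C x0)) has_derivative (\<lambda>w. blinfun_apply (frechet_D F (z *\<^sub>C x0)) (w *\<^sub>C x0))) (at z)"
      using bounded_clinear_frechet_D(2)[OF hF zx]
      by (intro has_derivative_compose[OF bounded_linear_imp_has_derivative[OF bounded_linear_scaleC_left]])
    moreover have "((\<lambda>z. F (z *\<^sub>C x0)) has_derivative (\<lambda>w. (deriv f z * w) *\<^sub>C x0)) (at z)"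
    proof -
      have "(f has_derivative (*) (deriv f z)) (at z)"
        using holomorphic_derivI[OF hf _ z, of UNIV] by (simp add: has_field_derivative_def)
      then have "((\<lambda>z. f z *\<^sub>C x0) has_derivative (\<lambda>w. (deriv f z * w) *\<^sub>C x0)) (at z)"
        by (rule bounded_linear.has_derivative[OF bounded_linear_scaleC_left])
      then show ?thesis
        by (rule has_derivative_transform_within_open[where s = "ball 0 1"]) (use z Fz in auto)
    qed
    ultimately have "(\<lambda>w. blinfun_apply (frechet_D F (z *\<^sub>C x0)) (w *\<^sub>C x0)) = (\<lambda>w. (deriv f z * w) *\<^sub>C x0)"
      by (rule has_derivative_unique)
    from fun_cong[OF this, of 1] show ?thesis by simp
  qed
  have nz: "deriv f z \<noteq> 0" if z: "z \<in> ball 0 1" for z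
  proof
    assume "deriv f z = 0"
    then have 0: "blinfun_apply (frechet_D F (z *\<^sub>C x0)) x0 = 0" using DF[OF z] by simp
    obtain L where "L o\<^sub>L frechet_D F (z *\<^sub>C x0) = id_blinfun"
      using inv scaleC_in_unit_ball[OF x0] z by blast
    from arg_cong[OF this, of "\<lambda>B. blinfun_apply B x0"] show False
      using 0 x00 by (simp add: blinfun.zero_right)
  qed
  have "Re (cis (- \<beta>) * (u z / deriv f z)) > 0" if z: "z \<in> ball 0 1" for z
  proof (cases "z = 0")
    \<comment> \<open>The spirallike condition omits the origin; there the quotient is 1 and the
      real part is \<open>cos \<beta>\<close>.\<close>
    case True
    then have "deriv f z = u 0"
      unfolding f_def using deriv_mult_ident[OF hu z] by simp
    then show ?thesis using True c by (simp add: u_def g0)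
  next
    case False
    have zx: "z *\<^sub>C x0 \<in> ball 0 1" using scaleC_in_unit_ball[OF x0] z by blast
    obtain L where L: "L o\<^sub>L frechet_D F (z *\<^sub>C x0) = id_blinfun" using inv[OF zx] by blast
    have "blinfun_apply (frechet_D F (z *\<^sub>C x0)) ((f z / deriv f z) *\<^sub>C x0) = F (z *\<^sub>C x0)"
      by (simp add: frechet_D_scaleC[OF hF zx] DF[OF z] Fz[OF z] scaleC_scaleC nz[OF z])
    then have "inv (blinfun_apply (frechet_D F (z *\<^sub>C x0))) (F (z *\<^sub>C x0)) = (f z / deriv f z) *\<^sub>C x0"
      by (rule inv_eq_of_left_inverse[OF L])
    then have "Re (cis (- \<beta>) * (of_real (cmod z) / z * T ((f z / deriv f z) *\<^sub>C x0))) > 0"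
      using pos[OF _ support_functionals_scaleC[OF T x0 False]] zx False x00 by simp
    \<comment> \<open>The \<open>z\<close> in \<open>f z = z * u z\<close> cancels the denominator
      and leaves the positive factor \<open>cmod z\<close>.\<close>
    moreover have "cis (- \<beta>) * (of_real (cmod z) / z * T ((f z / deriv f z) *\<^sub>C x0)) =
        of_real (cmod z) * (cis (- \<beta>) * (u z / deriv f z))"
      using False by (simp add: bounded_clinear_scaleC[OF T'(1)] T'(2) f_def)
    ultimately show ?thesis using False by (simp only: Re_of_real_mult) (simp add: zero_less_mult_iff)
  qed
  note bound = Hankel_bound_disc[OF hu _ c, folded f_def, OF _ nz this]
  \<comment> \<open>\<open>F\<close> is prescribed only on the unit ball, so the derivatives at 0
    are compared through agreement near 0.\<close>
  have "(\<lambda>z. T (F (z *\<^sub>C x0))) z = f z" if "z \<in> ball 0 1" for z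
    using that by (simp add: Fz bounded_clinear_scaleC[OF T'(1)] T'(2))
  moreover have "\<forall>\<^sub>F z in nhds 0. z \<in> ball (0::complex) 1" by (intro eventually_nhds_in_open) auto
  ultimately have "\<forall>\<^sub>F z in nhds 0. T (F (z *\<^sub>C x0)) = f z" by (auto elim: eventually_mono)
  then have "(deriv ^^ n) (\<lambda>z. T (F (z *\<^sub>C x0))) 0 = (deriv ^^ n) f 0" for n
    by (rule higher_deriv_cong_ev) simp
  then show ?thesis
    unfolding H22_def A_eq_higher_deriv[OF hF T'(1) x0] using bound by (simp add: u_def g0)
qed

section \<open>The extremal mapping\<close>

lemma bounded_bilinear_scaleC:
  "bounded_bilinear (\<lambda>c (x::'a::complex_banach). c *\<^sub>C x)"
proof
  show "\<exists>K. \<forall>c x. norm (c *\<^sub>C (x::'a)) \<le> cmod c * norm x * K"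
    by (intro exI[of _ 1]) (simp add: norm_scaleC)
qed (auto simp: scaleC_add_left scaleC_add_right scaleR_scaleC scaleC_scaleC scaleR_conv_of_real mult.commute)

lemma bounded_clinear_rank_one_perturbation:
  fixes x :: "'a::complex_banach"
  assumes T: "bounded_clinear T"
  shows "bounded_clinear (\<lambda>h. a *\<^sub>C (h + (c * T h) *\<^sub>C x))"
proof -
  have T': "bounded_linear T" "\<And>b h. T (b *\<^sub>C h) = b * T h" using T by (auto simp: bounded_clinear_def)
  have "bounded_linear (\<lambda>h. a *\<^sub>C (h + (c * T h) *\<^sub>C x))"
    using T'(1)
    by (intro bounded_linear_compose[OF bounded_linear_scaleC] bounded_linear_add bounded_linear_ident
        bounded_linear_compose[OF bounded_linear_scaleC_left] bounded_linear_compose[OF bounded_linear_mult_right])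
  then show ?thesis
    by (simp add: bounded_clinear_def T'(2) scaleC_scaleC scaleC_add_right mult_ac)
qed

text \<open>The Sherman-Morrison formula. \<open>B\<close> has the same shape as \<open>A\<close>,
  so its boundedness follows from the preceding lemma.\<close>

lemma rank_one_perturbation_inverse:
  fixes x :: "'a::complex_banach"
  assumes T: "bounded_clinear T" and a: "a \<noteq> 0" and p: "p = 1 + c * T x" "p \<noteq> 0"
  defines "A \<equiv> \<lambda>h. a *\<^sub>C (h + (c * T h) *\<^sub>C x)"
    and "B \<equiv> \<lambda>k. (1 / a) *\<^sub>C (k + (- (c / p) * T k) *\<^sub>C x)"
  shows "A (B k) = k" "B (A k) = k"
proof -
  have T': "T (h + k) = T h + T k" "T (b *\<^sub>C h) = b * T h" for b h k
    using T by (auto simp: bounded_clinear_def linear_add bounded_linear.linear)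
  have "T (B k) = T k / (a * p)" for k
  proof -
    have "T (B k) = (1 / a) * (T k * (1 - c * T x / p))" by (simp add: B_def T' algebra_simps)
    also have "1 - c * T x / p = 1 / p" using p by (simp add: field_simps)
    finally show ?thesis by simp
  qed
  then have "A (B k) = a *\<^sub>C B k + (a * (c * (T k / (a * p)))) *\<^sub>C x"
    by (simp only: A_def scaleC_add_right scaleC_scaleC)
  also have "a *\<^sub>C B k = k + (- (c / p) * T k) *\<^sub>C x"
    using a by (simp add: B_def scaleC_scaleC)
  also have "k + (- (c / p) * T k) *\<^sub>C x + (a * (c * (T k / (a * p)))) *\<^sub>C x = k + 0 *\<^sub>C x"
    unfolding add.assoc scaleC_add_left[symmetric] using a by simp
  finally show "A (B k) = k" by simp
  have "T (A k) = a * (T k * p)" by (simp add: A_def T' p algebra_simps)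
  then have "B (A k) = (1 / a) *\<^sub>C A k + ((1 / a) * (- (c / p) * (a * (T k * p)))) *\<^sub>C x"
    by (simp only: B_def scaleC_add_right scaleC_scaleC)
  also have "(1 / a) *\<^sub>C A k = k + (c * T k) *\<^sub>C x"
    using a by (simp add: A_def scaleC_scaleC)
  also have "k + (c * T k) *\<^sub>C x + ((1 / a) * (- (c / p) * (a * (T k * p)))) *\<^sub>C x = k + 0 *\<^sub>C x"
    unfolding add.assoc scaleC_add_left[symmetric] using a p(2) by simp
  finally show "B (A k) = k" by simp
qed

text \<open>The Moebius map \<open>1 / (1 - m)\<close> sends the unit disc into the half-plane of
  real part above 1/2. Multiplied by \<open>cis \<beta>\<close>, the denominator \<open>p\<close>
  thus has real part \<open>cos \<beta> (2 Re (1 / (1 - m)) - 1) > 0\<close>, and reciprocals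
  preserve the right half-plane.\<close>

lemma Re_spiral_Koebe_pos:
  assumes s: "cmod s < 1" and c: "cos \<beta> > 0"
  shows "Re (cis (- \<beta>) / (1 + 2 * (cis (- \<beta>) * of_real (cos \<beta>)) * s\<^sup>2 / (1 - s\<^sup>2))) > 0"
proof -
  define m where "m = s\<^sup>2"
  have m: "cmod m < 1" using s by (simp add: m_def norm_power power_less_one_iff)
  then have m1: "1 - m \<noteq> 0" by auto
  have "(cmod (1 - m))\<^sup>2 = 1 - 2 * Re m + (cmod m)\<^sup>2"
    unfolding cmod_power2 by (simp add: power2_eq_square algebra_simps)
  also have "\<dots> < 2 * Re (1 - m)" using m by (simp add: power_less_one_iff)
  finally have "2 * Re (1 - m) / (cmod (1 - m))\<^sup>2 > 1" using m1 by (simp add: less_divide_eq)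
  then have q: "2 * Re (1 / (1 - m)) > 1" by (simp add: Re_divide cmod_power2)
  have cc: "cis (- \<beta>) * cis \<beta> = 1" by (simp add: cis_mult)
  have e: "m / (1 - m) = 1 / (1 - m) - 1" using m1 by (simp add: field_simps)
  define p where "p = 1 + 2 * (cis (- \<beta>) * of_real (cos \<beta>)) * m / (1 - m)"
  have "cis \<beta> * p = cis \<beta> + of_real (2 * cos \<beta>) * (m / (1 - m)) * (cis (- \<beta>) * cis \<beta>)"
    by (simp add: p_def algebra_simps)
  then have "Re (cis \<beta> * p) = cos \<beta> + 2 * cos \<beta> * (Re (1 / (1 - m)) - 1)"
    unfolding cc e by (simp only: plus_complex.sel Re_complex_of_real mult_1_right cis.sel minus_complex.sel
        Re_of_real_mult one_complex.sel)
  also have "\<dots> = cos \<beta> * (2 * Re (1 / (1 - m)) - 1)" by (simp add: algebra_simps)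
  also have "\<dots> > 0" using c q by (intro mult_pos_pos) auto
  finally have r: "Re (cis \<beta> * p) > 0" .
  have "cis (- \<beta>) / p = 1 / (cis \<beta> * p)" by (simp add: cis_inverse[symmetric] divide_simps)
  moreover have "Re (1 / (cis \<beta> * p)) > 0" using r
    by (simp only: Re_divide) (auto simp: sum_power2_gt_zero_iff intro!: divide_pos_pos)
  ultimately show ?thesis by (simp add: p_def m_def)
qed

text \<open>Along \<open>x\<^sub>0\<close> the extremal mapping is \<open>z (1 - z\<^sup>2) powr (-\<tau>)\<close>, for which the Schwarz
  function is \<open>\<omega>(z) = z\<^sup>2\<close>.\<close>

lemma Hankel_sharp:
  fixes x0 :: "'a::complex_banach"
  assumes c: "cos \<beta> > 0" and x0: "norm x0 = 1" and T: "T \<in> support_functionals x0"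
  shows "\<exists>(g :: 'a \<Rightarrow> complex) F. holomorphic_map_on g (ball 0 1) \<and> g 0 = 1 \<and>
    (\<forall>x\<in>ball 0 1. F x = g x *\<^sub>C x) \<and> F \<in> spirallike \<beta> \<and> cmod (H22 F x0 T) = (cos \<beta>)\<^sup>2"
proof -
  define \<tau> where "\<tau> = cis (- \<beta>) * of_real (cos \<beta>)"
  define G where "G s = exp (- \<tau> * Ln (1 - s\<^sup>2))" for s
  \<comment> \<open>\<open>C\<close> is the logarithmic derivative of \<open>G\<close> on the unit
    disc.\<close>
  define C where "C s = 2 * \<tau> * s / (1 - s\<^sup>2)" for s
  define g where "g x = G (T x)" for x
  define F where "F x = g x *\<^sub>C x" for x
  have T': "bounded_clinear T" "bounded_linear T" "T x0 = 1" "T 0 = 0" "T (b *\<^sub>C h) = b * T h" for b h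
    using T x0 by (auto simp: support_functionals_def bounded_clinear_def linear_0 bounded_linear.linear)
  have Tx: "cmod (T x) < 1" if "x \<in> ball 0 1" for x
    using support_functionals_bound[OF T, of x] that by simp
  have Gd: "(G has_field_derivative G s * C s) (at s)" if "cmod s < 1" for s
  proof -
    \<comment> \<open>This keeps \<open>1 - s\<^sup>2\<close> off the branch cut of
      \<open>Ln\<close>.\<close>
    have m: "cmod (s\<^sup>2) < 1" using that by (simp add: norm_power power_less_one_iff)
    then have "Re (s\<^sup>2) < 1" using complex_Re_le_cmod[of "s\<^sup>2"] by linarith
    then have "1 - s\<^sup>2 \<notin> \<real>\<^sub>\<le>\<^sub>0" by (auto simp: complex_nonpos_Reals_iff)
    moreover have "1 - s\<^sup>2 \<noteq> 0" using m by auto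
    ultimately show ?thesis
      unfolding G_def C_def by (auto intro!: derivative_eq_intros simp: field_simps)
  qed
  have gd: "(g has_derivative (\<lambda>h. g x * C (T x) * T h)) (at x)" if "x \<in> ball 0 1" for x
    using has_derivative_compose[OF bounded_linear_imp_has_derivative[OF T'(2)]
        Gd[OF Tx[OF that], unfolded has_field_derivative_def]]
    by (simp add: g_def[abs_def])
  have hg: "holomorphic_map_on g (ball 0 1)"
    unfolding holomorphic_map_on_def
  proof (intro ballI exI conjI)
    fix x :: 'a assume "x \<in> ball 0 1"
    then show "(g has_derivative (\<lambda>h. g x * C (T x) * T h)) (at x)" by (rule gd)
    show "bounded_clinear (\<lambda>h. g x * C (T x) * T h)"
      using bounded_linear_compose[OF bounded_linear_mult_right T'(2)]
      by (auto simp: bounded_clinear_def T'(5))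
  qed
  \<comment> \<open>By the product rule the derivative of \<open>F\<close> is a multiple of a
    rank-one perturbation of the identity, hence explicitly invertible.\<close>
  define L where "L x h = g x *\<^sub>C (h + (C (T x) * T h) *\<^sub>C x)" for x h
  have Lc: "bounded_clinear (L x)" for x
    unfolding L_def by (rule bounded_clinear_rank_one_perturbation[OF T'(1)])
  have Fd: "(F has_derivative L x) (at x)" if "x \<in> ball 0 1" for x
    using bounded_bilinear.FDERIV[OF bounded_bilinear_scaleC gd[OF that] has_derivative_ident]
    by (simp add: F_def[abs_def] L_def[abs_def] scaleC_add_right scaleC_scaleC mult.assoc)
  have hF: "holomorphic_map_on F (ball 0 1)"
    unfolding holomorphic_map_on_def using Lc Fd by blast
  have DF: "blinfun_apply (frechet_D F x) = L x" if "x \<in> ball 0 1" for x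
    by (rule blinfun_apply_frechet_D[OF Fd[OF that]])
  have g0: "g 0 = 1" by (simp add: g_def T'(4) G_def)
  have gnz: "g x \<noteq> 0" for x by (simp add: g_def G_def)
  \<comment> \<open>\<open>DF(x) x = p(x) F(x)\<close> on the ball, so \<open>p\<close> plays the
    role of \<open>z f'(z) / f(z)\<close> at \<open>z = T x\<close>.\<close>
  define p where "p x = 1 + C (T x) * T x" for x
  have p: "Re (cis (- \<beta>) / p x) > 0" if "x \<in> ball 0 1" for x
    using Re_spiral_Koebe_pos[OF Tx[OF that] c] by (simp add: p_def C_def \<tau>_def power2_eq_square mult.assoc)
  then have pnz: "p x \<noteq> 0" if "x \<in> ball 0 1" for x using that by fastforce
  define J where "J x k = (1 / g x) *\<^sub>C (k + (- (C (T x) / p x) * T k) *\<^sub>C x)" for x k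
  have inv: "L x (J x k) = k" "J x (L x k) = k" if "x \<in> ball 0 1" for x k
    using rank_one_perturbation_inverse[OF T'(1) gnz p_def pnz[OF that]]
    unfolding L_def J_def by blast+
  have Jl: "blinfun_apply (Blinfun (J x)) = J x" for x
    unfolding J_def
    by (intro bounded_linear_Blinfun_apply bounded_clinear_imp_bounded_linear
        bounded_clinear_rank_one_perturbation T'(1))
  have JD: "Blinfun (J x) o\<^sub>L frechet_D F x = id_blinfun" "frechet_D F x o\<^sub>L Blinfun (J x) = id_blinfun"
    if "x \<in> ball 0 1" for x
    using inv[OF that] by (auto intro!: blinfun_eqI simp: Jl DF[OF that])
  have "normalized_map F"
    unfolding normalized_map_def
  proof
    show "frechet_D F 0 = id_blinfun"
      by (rule blinfun_eqI) (simp add: DF L_def g0)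
  qed (simp add: F_def)
  moreover have "locally_biholomorphic F"
    unfolding locally_biholomorphic_def using hF JD by blast
  moreover have "Re (exp (- \<i> * complex_of_real \<beta>) * S (inv (blinfun_apply (frechet_D F x)) (F x))) > 0"
    if x: "x \<in> ball 0 1 - {0}" and S: "S \<in> support_functionals x" for x S
  proof -
    have xb: "x \<in> ball 0 1" and nx: "norm x > 0" using x by auto
    have "1 / p x + C (T x) * ((1 / p x) * T x) = (1 + C (T x) * T x) / p x"
      by (simp add: add_divide_distrib)
    then have "(1 / p x) *\<^sub>C x + (C (T x) * ((1 / p x) * T x)) *\<^sub>C x = (p x / p x) *\<^sub>C x"
      unfolding scaleC_add_left[symmetric] by (simp only: p_def)
    then have "blinfun_apply (frechet_D F x) ((1 / p x) *\<^sub>C x) = F x"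
      using pnz[OF xb] by (simp add: DF[OF xb] L_def T'(5) F_def)
    then have "inv (blinfun_apply (frechet_D F x)) (F x) = (1 / p x) *\<^sub>C x"
      by (rule inv_eq_of_left_inverse[OF JD(1)[OF xb]])
    moreover have "S ((1 / p x) *\<^sub>C x) = of_real (norm x) / p x"
      using S by (simp add: support_functionals_def bounded_clinear_def)
    moreover have "exp (- \<i> * complex_of_real \<beta>) = cis (- \<beta>)" by (simp add: cis_conv_exp)
    ultimately have "Re (exp (- \<i> * complex_of_real \<beta>) * S (inv (blinfun_apply (frechet_D F x)) (F x)))
        = Re (of_real (norm x) * (cis (- \<beta>) / p x))" by (simp add: mult.commute)
    also have "\<dots> = norm x * Re (cis (- \<beta>) / p x)" by (simp only: Re_of_real_mult)
    also have "\<dots> > 0" using nx p[OF xb] by simp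
    finally show ?thesis .
  qed
  ultimately have spiral: "F \<in> spirallike \<beta>" unfolding spirallike_def by blast
  have Gh: "G holomorphic_on ball 0 1"
    unfolding holomorphic_on_def field_differentiable_def
    using Gd by (metis has_field_derivative_at_within mem_ball_0)
  define U where "U = fps_expansion G 0"
  \<comment> \<open>The differential equation \<open>(1 - z^2) G' = 2 \<tau> z G\<close> supplies
    the coefficients of \<open>G\<close> without expanding the power.\<close>
  have fps1: "(\<lambda>z. (1 - z * z) * deriv G z) has_fps_expansion (1 - fps_X * fps_X) * fps_deriv U"
    unfolding U_def by (intro fps_expansion_intros has_fps_expansion_unit_disc Gh)
  have fps2: "(\<lambda>z. (2 * \<tau>) * (z * G z)) has_fps_expansion fps_const (2 * \<tau>) * (fps_X * U)"
    unfolding U_def by (intro fps_expansion_intros has_fps_expansion_unit_disc Gh)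
  have "(1 - fps_X * fps_X) * fps_deriv U = fps_const (2 * \<tau>) * (fps_X * U)"
  proof (rule fps_eq_on_unit_disc[OF fps1 fps2])
    fix z :: complex assume z: "z \<in> ball 0 1"
    then have "cmod (z\<^sup>2) < 1" by (simp add: norm_power power_less_one_iff)
    then have "1 - z\<^sup>2 \<noteq> 0" by auto
    moreover have "deriv G z = G z * C z" using Gd z by (intro DERIV_imp_deriv) auto
    ultimately show "(1 - z * z) * deriv G z = (2 * \<tau>) * (z * G z)"
      by (simp add: C_def power2_eq_square)
  qed
  note eq = arg_cong[OF this, of "\<lambda>F. fps_nth F n" for n]
  have U0: "fps_nth U 0 = 1" by (simp add: U_def fps_expansion_nth_0 G_def)
  have U1: "fps_nth U 1 = 0"
    using eq[of 0] by (simp add: fps_mult_nth)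
  have U2: "fps_nth U 2 = \<tau>"
    using eq[of 1] U0 by (simp add: fps_mult_nth numeral_2_eq_2)
  have f: "(\<lambda>z. T (F (z *\<^sub>C x0))) = (\<lambda>z. z * G z)"
    by (simp add: F_def g_def T' mult.commute)
  \<comment> \<open>With these values the determinant is \<open>- \<tau>^2\<close>, whatever
    \<open>A4\<close> is.\<close>
  have "A2 F x0 T = 0" "A3 F x0 T = \<tau>"
    unfolding A_eq_higher_deriv[OF hF T'(1) x0] f
    using higher_deriv_mult_ident[OF Gh, of 1, folded U_def] higher_deriv_mult_ident[OF Gh, of 2, folded U_def]
      U1 U2 by (simp_all add: numeral_eq_Suc)
  then have "cmod (H22 F x0 T) = (cos \<beta>)\<^sup>2" by (simp add: H22_def \<tau>_def norm_mult norm_power)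
  then show ?thesis using hg g0 spiral F_def by blast
qed

theorem theorem3p1:
  fixes \<beta> :: real
  assumes nonzero: "\<exists>x::'a::complex_banach. x \<noteq> 0"
    and beta: "\<bar>\<beta>\<bar> \<le> pi / 3"
  shows "(\<forall>(g :: 'a \<Rightarrow> complex) (F :: 'a \<Rightarrow> 'a).
            holomorphic_map_on g (ball 0 1) \<longrightarrow> g 0 = 1 \<longrightarrow>
            (\<forall>x\<in>ball 0 1. F x = g x *\<^sub>C x) \<longrightarrow> F \<in> spirallike \<beta> \<longrightarrow>
            (\<forall>x0. norm x0 = 1 \<longrightarrow> (\<forall>T\<in>support_functionals x0.
               cmod (H22 F x0 T) \<le> (cos \<beta>)\<^sup>2)))
       \<and> (\<exists>(g :: 'a \<Rightarrow> complex) (F :: 'a \<Rightarrow> 'a).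
            holomorphic_map_on g (ball 0 1) \<and> g 0 = 1 \<and>
            (\<forall>x\<in>ball 0 1. F x = g x *\<^sub>C x) \<and> F \<in> spirallike \<beta> \<and>
            (\<exists>x0. norm x0 = 1 \<and> (\<exists>T\<in>support_functionals x0.
               cmod (H22 F x0 T) = (cos \<beta>)\<^sup>2)))"
proof
  have c: "cos \<beta> > 0" using beta pi_gt_zero by (intro cos_gt_zero_pi) linarith+
  show "\<forall>(g :: 'a \<Rightarrow> complex) (F :: 'a \<Rightarrow> 'a).
      holomorphic_map_on g (ball 0 1) \<longrightarrow> g 0 = 1 \<longrightarrow>
      (\<forall>x\<in>ball 0 1. F x = g x *\<^sub>C x) \<longrightarrow> F \<in> spirallike \<beta> \<longrightarrow>
      (\<forall>x0. norm x0 = 1 \<longrightarrow> (\<forall>T\<in>support_functionals x0. cmod (H22 F x0 T) \<le> (cos \<beta>)\<^sup>2))"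
    using Hankel_bound[OF c] by blast
  obtain v :: 'a where v: "v \<noteq> 0" using nonzero by blast
  define x0 where "x0 = v /\<^sub>R norm v"
  have x0: "norm x0 = 1" using v by (simp add: x0_def)
  then obtain T where T: "T \<in> support_functionals x0" using support_functional_exists[of x0] by fastforce
  show "\<exists>(g :: 'a \<Rightarrow> complex) (F :: 'a \<Rightarrow> 'a).
      holomorphic_map_on g (ball 0 1) \<and> g 0 = 1 \<and>
      (\<forall>x\<in>ball 0 1. F x = g x *\<^sub>C x) \<and> F \<in> spirallike \<beta> \<and>
      (\<exists>x0. norm x0 = 1 \<and> (\<exists>T\<in>support_functionals x0. cmod (H22 F x0 T) = (cos \<beta>)\<^sup>2))"
    using Hankel_sharp[OF c x0 T] x0 T by blast
qed

end
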